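(* Consider the nonlinear-policy proximal-gradient Bellman-ADMM described in the context. Let $\kappa_M=\sup_\theta\|M_\theta^{-1}\|$, $A_A=3\kappa_M^4L_M^2\|c\|^2$, $B_A=3\kappa_M^2/\eta_V^2$, suppose $\frac{B_A}\beta<\tau<\frac1{2\eta_V}-\frac{B_A}\beta$, and set $\Phi_k^A=\mathcal L_\beta(\theta^k,V^k,\lambda^k)+\tau\|\Delta V_k\|^2$. Assume $D_\theta M_\theta$ and $D_\theta r_\theta$ are uniformly bounded on the visited region and $\nabla h_k$ is $L_{\theta,k}$-Lipschitz on every policy comparison segment $[\theta^k,\theta^{k+1}]$, with $0<\underline\eta\le\eta_{\theta,k}$ and $L_{\theta,k}\le\overline L<\infty$ for all $k$. If $$\frac1{2\eta_{\theta,k}}-\frac{L_{\theta,k}}2-\frac{A_A}\beta\ge\alpha_\theta>0\quad\text{for all }k,$$ then the corrected Lyapunov function decreases, $\Phi_{k+1}^A\le\Phi_k^A$ for $k\ge1$, and the KKT residual converges to zero, $G_k^A:=G^A(\theta^k,V^k,\lambda^k)\to0$. Moreover there is $C_G<\infty$ such that for all $k\ge1$ $$G_{k+1}^A\le C_G\big(\|\Delta\theta_{k+1}\|^2+\|\Delta V_{k+1}\|^2+\|\Delta V_k\|^2\big),$$ so that $\min_{1\le k\le T}G_k^A\le C/T$ for a constant $C$ independent of $T$.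
   Context: Norms are Euclidean/spectral. $(\mathcal S,\mathcal A,P,r,\gamma)$ is a finite discounted MDP with $0<\gamma<1$. $\Theta\subset\mathbb R^p$ is closed and convex and $\theta\mapsto\pi_\theta$ is a smooth policy map (each $\pi_\theta(\cdot|s)$ a probability vector) on a neighborhood of $\Theta$. $P_\theta(s'|s)=\sum_a\pi_\theta(a|s)P(s'|s,a)$, $r_\theta(s)=\sum_a\pi_\theta(a|s)r(s,a)$, $M_\theta=I-\gamma P_\theta$, $R(\theta,V)=M_\theta V-r_\theta$. The problem is $\min_{\theta\in\Theta,V}\phi(\theta)+c^{\mathsf T}V$ s.t. $R(\theta,V)=0$, $c\in\mathbb R^{|\mathcal S|}$; $\psi_\Theta=\phi+\delta_\Theta$ ($\delta_\Theta$ the indicator) is proper, lower semicontinuous and bounded below, and $\partial\psi_\Theta$ is the limiting subdifferential. Assume $\|M_\theta-M_{\theta'}\|\le L_M\|\theta-\theta'\|$ on $\Theta$ and that $b_A(\theta)=\phi(\theta)+c^{\mathsf T}M_\theta^{-1}r_\theta$ is bounded below on $\Theta$. Augmented Lagrangian: $\mathcal L_\beta(\theta,V,\lambda)=\phi(\theta)+c^{\mathsf T}V+\langle\lambda,R(\theta,V)\rangle+\frac\beta2\|R(\theta,V)\|^2$. Squared KKT residual: $G^A(\theta,V,\lambda)=\operatorname{dist}^2(0,\partial\psi_\Theta(\theta)+D_\theta R(\theta,V)^{\mathsf T}\lambda)+\|c+M_\theta^{\mathsf T}\lambda\|^2+\|R(\theta,V)\|^2$. Algorithm (deterministic, $\beta,\eta_V,\eta_{\theta,k}>0$),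 from $\theta^0\in\operatorname{dom}\psi_\Theta$ and finite $V^0,\lambda^0$: with $h_k(\theta)=\langle\lambda^k,R(\theta,V^k)\rangle+\frac\beta2\|R(\theta,V^k)\|^2$, for $k\ge0$, $\theta^{k+1}\in\arg\min_{\theta\in\Theta}\{\phi(\theta)+\langle\nabla h_k(\theta^k),\theta-\theta^k\rangle+\frac1{2\eta_{\theta,k}}\|\theta-\theta^k\|^2\}$; $V^{k+1}=\arg\min_V\{\mathcal L_\beta(\theta^{k+1},V,\lambda^k)+\frac1{2\eta_V}\|V-V^k\|^2\}$; $\lambda^{k+1}=\lambda^k+\beta R(\theta^{k+1},V^{k+1})$. $\Delta\theta_{k+1}=\theta^{k+1}-\theta^k$, and similarly for $V,\lambda$. *)

theory Defs
  imports "HOL-Analysis.Analysis"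
begin

subsection \<open>Extended-real-valued functions and limiting subdifferentials\<close>

definition proper_fun :: "('a \<Rightarrow> ereal) \<Rightarrow> bool" where
  "proper_fun f \<longleftrightarrow> (\<forall>x. f x \<noteq> -\<infinity>) \<and> (\<exists>x. f x \<noteq> \<infinity>)"

definition lsc_fun :: "('a::topological_space \<Rightarrow> ereal) \<Rightarrow> bool" where
  "lsc_fun f \<longleftrightarrow> (\<forall>x. f x \<le> Liminf (at x) f)"

definition bounded_below_on :: "'a set \<Rightarrow> ('a \<Rightarrow> ereal) \<Rightarrow> bool" where
  "bounded_below_on S f \<longleftrightarrow> (\<exists>m::real. \<forall>x\<in>S. ereal m \<le> f x)"

text \<open>Sum of \<open>f\<close> and the indicator function of \<open>S\<close> (\<open>0\<close> on \<open>S\<close>, \<open>\<infinity>\<close> off \<open>S\<close>); the values of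
  \<open>f\<close> off \<open>S\<close> play no role.\<close>
definition restrict_to :: "'a set \<Rightarrow> ('a \<Rightarrow> ereal) \<Rightarrow> 'a \<Rightarrow> ereal" where
  "restrict_to S f x = (if x \<in> S then f x else \<infinity>)"

definition regular_subdiff :: "('a::euclidean_space \<Rightarrow> ereal) \<Rightarrow> 'a \<Rightarrow> 'a set" where
  "regular_subdiff f x =
     {v. \<bar>f x\<bar> \<noteq> \<infinity> \<and>
         0 \<le> Liminf (at x) (\<lambda>y. (f y - f x - ereal (v \<bullet> (y - x))) / ereal (norm (y - x)))}"

definition limiting_subdiff :: "('a::euclidean_space \<Rightarrow> ereal) \<Rightarrow> 'a \<Rightarrow> 'a set" where
  "limiting_subdiff f x =
     {v. \<bar>f x\<bar> \<noteq> \<infinity> \<and>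
         (\<exists>X W. X \<longlonglongrightarrow> x \<and> (\<lambda>n. f (X n)) \<longlonglongrightarrow> f x \<and>
                (\<forall>n. W n \<in> regular_subdiff f (X n)) \<and> W \<longlonglongrightarrow> v)}"

text \<open>Distance to a set with the convention that the distance to the empty set is \<open>\<infinity>\<close>
  (whereas \<^const>\<open>infdist\<close> returns \<open>0\<close> there).\<close>
definition edist_set :: "'a::metric_space \<Rightarrow> 'a set \<Rightarrow> ereal" where
  "edist_set x S = (INF y\<in>S. ereal (dist x y))"

subsection \<open>Differentiability\<close>

text \<open>Meaningful for open \<open>U\<close>.\<close>
fun Ck_on :: "nat \<Rightarrow> ('a::euclidean_space \<Rightarrow> real) \<Rightarrow> 'a set \<Rightarrow> bool" where
  "Ck_on 0 f U \<longleftrightarrow> continuous_on U f"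
| "Ck_on (Suc k) f U \<longleftrightarrow>
     f differentiable_on U \<and> (\<forall>b\<in>Basis. Ck_on k (\<lambda>x. frechet_derivative f (at x) b) U)"

definition smooth_fun_on :: "('a::euclidean_space \<Rightarrow> real) \<Rightarrow> 'a set \<Rightarrow> bool" where
  "smooth_fun_on f U \<longleftrightarrow> (\<forall>k. Ck_on k f U)"

definition grad :: "('a::euclidean_space \<Rightarrow> real) \<Rightarrow> 'a \<Rightarrow> 'a" where
  "grad f x = (THE g. GDERIV f x :> g)"

text \<open>The library norm on \<^typ>\<open>real^'n^'m\<close> is the Frobenius norm, hence a separate name for the
  spectral norm.\<close>
definition spectral_norm :: "real^'n^'m \<Rightarrow> real" where
  "spectral_norm A = onorm ((*v) A)"

subsection \<open>Discounted Markov decision processes with parametrized policies\<close>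

text \<open>\<open>P s a s'\<close> is the probability of moving from \<open>s\<close> to \<open>s'\<close> under action \<open>a\<close>.\<close>
definition transition_kernel :: "('s::finite \<Rightarrow> 'a::finite \<Rightarrow> 's \<Rightarrow> real) \<Rightarrow> bool" where
  "transition_kernel P \<longleftrightarrow>
     (\<forall>s a. (\<forall>s'. 0 \<le> P s a s') \<and> (\<Sum>s'\<in>UNIV. P s a s') = 1)"

definition smooth_policy_on ::
  "(real^'p) set \<Rightarrow> (real^'p \<Rightarrow> 's::finite \<Rightarrow> 'a::finite \<Rightarrow> real) \<Rightarrow> bool" where
  "smooth_policy_on U \<pi> \<longleftrightarrow>
     (\<forall>\<theta>\<in>U. \<forall>s. (\<forall>a. 0 \<le> \<pi> \<theta> s a) \<and> (\<Sum>a\<in>UNIV. \<pi> \<theta> s a) = 1) \<and>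
     (\<forall>s a. smooth_fun_on (\<lambda>\<theta>. \<pi> \<theta> s a) U)"

definition policy_trans ::
  "('s::finite \<Rightarrow> 'a::finite \<Rightarrow> 's \<Rightarrow> real) \<Rightarrow> ('t \<Rightarrow> 's \<Rightarrow> 'a \<Rightarrow> real) \<Rightarrow> 't \<Rightarrow> real^'s^'s" where
  "policy_trans P \<pi> \<theta> = (\<chi> s s'. \<Sum>a\<in>UNIV. \<pi> \<theta> s a * P s a s')"

definition policy_reward ::
  "('s::finite \<Rightarrow> 'a::finite \<Rightarrow> real) \<Rightarrow> ('t \<Rightarrow> 's \<Rightarrow> 'a \<Rightarrow> real) \<Rightarrow> 't \<Rightarrow> real^'s" where
  "policy_reward r \<pi> \<theta> = (\<chi> s. \<Sum>a\<in>UNIV. \<pi> \<theta> s a * r s a)"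

definition bellman_matrix ::
  "('s::finite \<Rightarrow> 'a::finite \<Rightarrow> 's \<Rightarrow> real) \<Rightarrow> real \<Rightarrow> ('t \<Rightarrow> 's \<Rightarrow> 'a \<Rightarrow> real) \<Rightarrow> 't \<Rightarrow> real^'s^'s" where
  "bellman_matrix P \<gamma> \<pi> \<theta> = mat 1 - \<gamma> *\<^sub>R policy_trans P \<pi> \<theta>"

definition bellman_residual ::
  "('s::finite \<Rightarrow> 'a::finite \<Rightarrow> 's \<Rightarrow> real) \<Rightarrow> ('s \<Rightarrow> 'a \<Rightarrow> real) \<Rightarrow> real \<Rightarrow>
   ('t \<Rightarrow> 's \<Rightarrow> 'a \<Rightarrow> real) \<Rightarrow> 't \<Rightarrow> real^'s \<Rightarrow> real^'s" where
  "bellman_residual P r \<gamma> \<pi> \<theta> V = bellman_matrix P \<gamma> \<pi> \<theta> *v V - policy_reward r \<pi> \<theta>"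

text \<open>The reduced objective \<open>b\<^sub>A\<close>.\<close>
definition reduced_objective ::
  "('t \<Rightarrow> ereal) \<Rightarrow> real^'s \<Rightarrow> ('s::finite \<Rightarrow> 'a::finite \<Rightarrow> 's \<Rightarrow> real) \<Rightarrow> ('s \<Rightarrow> 'a \<Rightarrow> real) \<Rightarrow>
   real \<Rightarrow> ('t \<Rightarrow> 's \<Rightarrow> 'a \<Rightarrow> real) \<Rightarrow> 't \<Rightarrow> ereal" where
  "reduced_objective \<phi> c P r \<gamma> \<pi> \<theta> =
     \<phi> \<theta> + ereal (c \<bullet> (matrix_inv (bellman_matrix P \<gamma> \<pi> \<theta>) *v policy_reward r \<pi> \<theta>))"

subsection \<open>Augmented Lagrangian, KKT residual and algorithm\<close>

text \<open>In the constants below, \<open>R\<close> is a residual map \<open>(\<theta>, V) \<mapsto> R(\<theta>, V)\<close> and \<open>M\<close> a matrix-valued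
  map \<open>\<theta> \<mapsto> M\<^sub>\<theta>\<close>; they are instantiated with \<^const>\<open>bellman_residual\<close> and
  \<^const>\<open>bellman_matrix\<close>.\<close>

definition penalty ::
  "('t \<Rightarrow> real^'s \<Rightarrow> real^'s) \<Rightarrow> real \<Rightarrow> real^'s \<Rightarrow> real^'s \<Rightarrow> 't \<Rightarrow> real" where
  "penalty R \<beta> V l \<theta> = l \<bullet> R \<theta> V + \<beta> / 2 * (norm (R \<theta> V))\<^sup>2"

definition aug_lagrangian ::
  "('t \<Rightarrow> ereal) \<Rightarrow> real^'s \<Rightarrow> ('t \<Rightarrow> real^'s \<Rightarrow> real^'s) \<Rightarrow> real \<Rightarrow>
   't \<Rightarrow> real^'s \<Rightarrow> real^'s \<Rightarrow> ereal" where
  "aug_lagrangian \<phi> c R \<beta> \<theta> V l =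
     \<phi> \<theta> + ereal (c \<bullet> V + l \<bullet> R \<theta> V + \<beta> / 2 * (norm (R \<theta> V))\<^sup>2)"

definition kkt_residual ::
  "(real^'p \<Rightarrow> ereal) \<Rightarrow> (real^'p) set \<Rightarrow> real^'s \<Rightarrow> (real^'p \<Rightarrow> real^'s^'s) \<Rightarrow>
   (real^'p \<Rightarrow> real^'s \<Rightarrow> real^'s) \<Rightarrow> real^'p \<Rightarrow> real^'s \<Rightarrow> real^'s \<Rightarrow> ereal" where
  "kkt_residual \<phi> \<Theta> c M R \<theta> V l =
     (edist_set 0 ((\<lambda>v. v + adjoint (frechet_derivative (\<lambda>\<theta>. R \<theta> V) (at \<theta>)) l) `
                     limiting_subdiff (restrict_to \<Theta> \<phi>) \<theta>))\<^sup>2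
     + ereal ((norm (c + transpose (M \<theta>) *v l))\<^sup>2 + (norm (R \<theta> V))\<^sup>2)"

text \<open>\<open>\<theta>\<close>, \<open>V\<close>, \<open>l\<close> are the sequences of iterates. The update of \<open>\<theta>\<close> need not have a unique
  minimizer, so the algorithm is a predicate on sequences.\<close>
definition bellman_admm ::
  "(real^'p \<Rightarrow> ereal) \<Rightarrow> (real^'p) set \<Rightarrow> real^'s \<Rightarrow> (real^'p \<Rightarrow> real^'s \<Rightarrow> real^'s) \<Rightarrow>
   real \<Rightarrow> real \<Rightarrow> (nat \<Rightarrow> real) \<Rightarrow>
   (nat \<Rightarrow> real^'p) \<Rightarrow> (nat \<Rightarrow> real^'s) \<Rightarrow> (nat \<Rightarrow> real^'s) \<Rightarrow> bool" where
  "bellman_admm \<phi> \<Theta> c R \<beta> \<eta>V \<eta> \<theta> V l \<longleftrightarrow>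
     restrict_to \<Theta> \<phi> (\<theta> 0) < \<infinity> \<and>
     (\<forall>k.
        is_arg_min
          (\<lambda>t. \<phi> t + ereal (grad (penalty R \<beta> (V k) (l k)) (\<theta> k) \<bullet> (t - \<theta> k)
                            + 1 / (2 * \<eta> k) * (norm (t - \<theta> k))\<^sup>2))
          (\<lambda>t. t \<in> \<Theta>) (\<theta> (Suc k)) \<and>
        is_arg_min
          (\<lambda>W. aug_lagrangian \<phi> c R \<beta> (\<theta> (Suc k)) W (l k)
               + ereal (1 / (2 * \<eta>V) * (norm (W - V k))\<^sup>2))
          (\<lambda>W. True) (V (Suc k)) \<and>
        l (Suc k) = l k + \<beta> *\<^sub>R R (\<theta> (Suc k)) (V (Suc k)))"

text \<open>Backward difference, only used for \<open>k \<ge> 1\<close>.\<close>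
definition bdiff :: "(nat \<Rightarrow> 'a::ab_group_add) \<Rightarrow> nat \<Rightarrow> 'a" where
  "bdiff x k = x k - x (k - 1)"

definition lyapunov ::
  "('t \<Rightarrow> ereal) \<Rightarrow> real^'s \<Rightarrow> ('t \<Rightarrow> real^'s \<Rightarrow> real^'s) \<Rightarrow> real \<Rightarrow> real \<Rightarrow>
   (nat \<Rightarrow> 't) \<Rightarrow> (nat \<Rightarrow> real^'s) \<Rightarrow> (nat \<Rightarrow> real^'s) \<Rightarrow> nat \<Rightarrow> ereal" where
  "lyapunov \<phi> c R \<beta> \<tau> \<theta> V l k =
     aug_lagrangian \<phi> c R \<beta> (\<theta> k) (V k) (l k) + ereal (\<tau> * (norm (bdiff V k))\<^sup>2)"

end

(*
  Stationarity of the V-step together with the multiplier update reads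
  c + M^T lambda + (V-increment)/eta_V = 0 after every iteration. It therefore expresses lambda
  through theta and the last V-increment: multiplier increments are controlled by primal increments
  (whence A_A and B_A), and substituting it into the Lagrangian bounds the corrected Lyapunov
  function below by the reduced objective. The decrease is thus summable in the squared increments.
  Optimality of the theta-step produces an element of the subdifferential whose distance from
  stationarity is linear in the increments, because V and lambda stay bounded.
*)
theory Submission
  imports Defs
begin

text \<open>Because the V-step is proximal, the identity for lambda carries the latest V-increment,
  so comparing two consecutive multipliers brings in two V-increments. The older one has no negative
  term of its own in the Lagrangian estimate; the correction with weight \<tau> supplies one, and
  the two bounds on \<tau> leave positive weight on both. The initial multiplier satisfies no such
  identity, which is why the comparison starts at k = 1 and the first residual is treated separately
  in the rate. Boundedness of V and lambda is derived: summable decrease bounds the V-increments,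
  hence lambda, hence R as a multiple of the multiplier increment, and V is then recovered from R by
  inverting \<open>M\<close>. This inversion is uniform in the policy because a discounted average
  cannot cancel the largest coordinate of a vector.\<close>

section \<open>Spectral norm and matrix inverses\<close>

lemma norm_matrix_vector_mult_le: "norm (A *v x) \<le> spectral_norm A * norm x"
  unfolding spectral_norm_def by (rule onorm) simp

lemma spectral_norm_nonneg: "0 \<le> spectral_norm A"
  unfolding spectral_norm_def by (rule onorm_pos_le) simp

lemma spectral_norm_le: "(\<And>x. norm (A *v x) \<le> b * norm x) \<Longrightarrow> spectral_norm A \<le> b"
  unfolding spectral_norm_def by (rule onorm_le)

text \<open>Transposition does not increase the spectral norm: pair the row product with itself,
  move \<open>A\<close> to the other factor, and cancel one \<open>norm (x v* A)\<close>.\<close>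

lemma norm_vector_matrix_mult_le: "norm (x v* A) \<le> spectral_norm A * norm x"
proof (cases "x v* A = 0")
  case True
  then show ?thesis by (simp add: spectral_norm_nonneg)
next
  case False
  have "norm (x v* A) * norm (x v* A) = (x v* A) \<bullet> (x v* A)"
    by (simp add: dot_square_norm power2_eq_square)
  also have "\<dots> = x \<bullet> (A *v (x v* A))" by (rule dot_lmul_matrix)
  also have "\<dots> \<le> norm x * norm (A *v (x v* A))" by (rule norm_cauchy_schwarz)
  also have "\<dots> \<le> norm x * (spectral_norm A * norm (x v* A))"
    by (intro mult_left_mono norm_matrix_vector_mult_le) simp
  also have "\<dots> = (spectral_norm A * norm x) * norm (x v* A)" by simp
  finally show ?thesis using False by simp
qed

text \<open>\<open>matrix_inv\<close> is a choice, so its identities require that an inverse exists;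
  for a square matrix a trivial kernel provides one.\<close>

lemma matrix_inv_cancel:
  fixes A :: "real^'n^'n"
  assumes "\<And>x. A *v x = 0 \<Longrightarrow> x = 0"
  shows "matrix_inv A ** A = mat 1" and "A ** matrix_inv A = mat 1"
proof -
  have "invertible A"
    using assms unfolding invertible_left_inverse matrix_left_invertible_ker by blast
  then have "A ** matrix_inv A = mat 1 \<and> matrix_inv A ** A = mat 1"
    unfolding invertible_def matrix_inv_def by (rule someI_ex)
  then show "matrix_inv A ** A = mat 1" and "A ** matrix_inv A = mat 1" by (rule conjunct2, rule conjunct1)
qed

section \<open>Gradients, descent along a segment and proximal subgradients\<close>

lemma GDERIV_unique:
  assumes "GDERIV f x :> a" "GDERIV f x :> b"
  shows "a = b"
proof -
  have "(\<lambda>h. h \<bullet> a) = (\<lambda>h. h \<bullet> b)"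
    using has_derivative_unique[OF assms[unfolded gderiv_def]] .
  from fun_cong[OF this, of "a - b"] have "(a - b) \<bullet> (a - b) = 0"
    by (simp add: inner_diff_right)
  then show "a = b" by simp
qed

lemma grad_eq: "GDERIV f x :> g \<Longrightarrow> grad f x = g"
  unfolding grad_def by (rule the_equality, assumption, erule GDERIV_unique, assumption)

lemma GDERIV_minimum_zero:
  assumes "GDERIV f x :> g" "\<And>y. f x \<le> f y"
  shows "g = 0"
proof -
  have "(\<lambda>h. h \<bullet> g) = (\<lambda>h. 0)"
    using assms unfolding gderiv_def by (intro differential_zero_maxmin[of x UNIV f]) auto
  then have "g \<bullet> g = 0" by (rule fun_cong)
  then show ?thesis by simp
qed

lemma descent_inequality:
  fixes f :: "'a::real_inner \<Rightarrow> real"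
  assumes deriv: "\<And>z. z \<in> closed_segment x y \<Longrightarrow> GDERIV f z :> g z"
    and lip: "L-lipschitz_on (closed_segment x y) g"
  shows "f y \<le> f x + g x \<bullet> (y - x) + L / 2 * (norm (y - x))\<^sup>2"
proof -
  define d where "d = y - x"
  define q where "q t = f (x + t *\<^sub>R d) - t * (g x \<bullet> d) - L / 2 * t\<^sup>2 * (norm d)\<^sup>2" for t
  have seg: "x + t *\<^sub>R d \<in> closed_segment x y" if "0 \<le> t" "t \<le> 1" for t
    using that by (auto simp: closed_segment_def d_def algebra_simps intro!: exI[of _ t])
  have "q 1 \<le> q 0"
  proof (rule DERIV_nonpos_imp_nonincreasing[of 0 1 q])
    fix t :: real assume t: "0 \<le> t" "t \<le> 1"
    have "(f has_derivative (\<lambda>h. h \<bullet> g (x + t *\<^sub>R d))) (at (x + t *\<^sub>R d))"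
      using deriv[OF seg[OF t]] by (simp add: gderiv_def)
    then have "((\<lambda>t. f (x + t *\<^sub>R d)) has_derivative (\<lambda>s. (s *\<^sub>R d) \<bullet> g (x + t *\<^sub>R d))) (at t)"
      by (rule has_derivative_compose[rotated]) (auto intro!: derivative_eq_intros)
    then have "((\<lambda>t. f (x + t *\<^sub>R d)) has_real_derivative d \<bullet> g (x + t *\<^sub>R d)) (at t)"
      by (simp add: has_field_derivative_def mult_commute_abs)
    then have D: "(q has_real_derivative
        d \<bullet> g (x + t *\<^sub>R d) - g x \<bullet> d - L * t * (norm d)\<^sup>2) (at t)"
      unfolding q_def by (auto intro!: derivative_eq_intros)
    have "(g (x + t *\<^sub>R d) - g x) \<bullet> d \<le> norm (g (x + t *\<^sub>R d) - g x) * norm d"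
      by (rule norm_cauchy_schwarz)
    also have "\<dots> \<le> (L * norm (t *\<^sub>R d)) * norm d"
      using lipschitz_onD[OF lip seg[OF t], of x]
      by (intro mult_right_mono) (auto simp: dist_norm)
    also have "\<dots> = L * t * (norm d)\<^sup>2"
      using t by (simp add: power2_eq_square)
    finally show "\<exists>D. (q has_real_derivative D) (at t) \<and> D \<le> 0"
      by (intro exI[of _ "d \<bullet> g (x + t *\<^sub>R d) - g x \<bullet> d - L * t * (norm d)\<^sup>2"] conjI D)
         (simp add: inner_diff_left inner_commute[of d])
  qed simp
  then show ?thesis by (simp add: q_def d_def)
qed

text \<open>Minimality compares \<phi> with a quadratic whose gradient at x is minus the claimed
  subgradient. The first-order quotient is therefore at least -a times the distance to x, and its
  lower limit is nonnegative. Where the restricted function is infinite, so is the quotient.\<close>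

lemma prox_minimizer_regular_subdiff:
  fixes \<phi> :: "'a::euclidean_space \<Rightarrow> ereal"
  assumes x: "x \<in> S" "\<phi> x = ereal p"
    and min: "\<And>y. y \<in> S \<Longrightarrow>
        \<phi> x + ereal (g \<bullet> (x - z) + a * (norm (x - z))\<^sup>2) \<le>
        \<phi> y + ereal (g \<bullet> (y - z) + a * (norm (y - z))\<^sup>2)"
  shows "- g - (2 * a) *\<^sub>R (x - z) \<in> regular_subdiff (restrict_to S \<phi>) x"
proof -
  define v where "v = - g - (2 * a) *\<^sub>R (x - z)"
  define q where "q y = g \<bullet> (y - z) + a * (norm (y - z))\<^sup>2" for y
  \<comment> \<open>The second-order expansion of the quadratic \<open>q\<close> at x is exact, and
    its gradient there is -v.\<close>
  have q: "q x - q y - v \<bullet> (y - x) = - a * (norm (y - x))\<^sup>2" for y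
  proof -
    have "(g \<bullet> w + a * (w \<bullet> w)) - (g \<bullet> (u + w) + a * ((u + w) \<bullet> (u + w)))
        - (- g - (2 * a) *\<^sub>R w) \<bullet> u = - a * (u \<bullet> u)" for u w
      by (simp add: inner_add_left inner_add_right inner_diff_left inner_commute[of u w]) algebra
    from this[of "x - z" "y - x"] show ?thesis
      by (simp add: q_def v_def power2_norm_eq_inner)
  qed
  have bound: "ereal (- a * norm (y - x)) \<le>
      (restrict_to S \<phi> y - restrict_to S \<phi> x - ereal (v \<bullet> (y - x))) / ereal (norm (y - x))"
    if "y \<noteq> x" for y
  proof (cases "y \<in> S")
    case True
    have m: "\<phi> x + ereal (q x) \<le> \<phi> y + ereal (q y)"
      using min[OF True] by (simp add: q_def)
    show ?thesis
    proof (cases "\<phi> y")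
      case (real s)
      have "- a * (norm (y - x))\<^sup>2 \<le> s - p - v \<bullet> (y - x)"
        using m q[of y] by (simp add: x real)
      then have "- a * norm (y - x) \<le> (s - p - v \<bullet> (y - x)) / norm (y - x)"
        using that by (simp add: field_simps power2_eq_square)
      then show ?thesis using that True x by (simp add: real restrict_to_def)
    qed (use m that True x in \<open>auto simp: restrict_to_def\<close>)
  next
    case False
    then show ?thesis using that x by (simp add: restrict_to_def)
  qed
  have "((\<lambda>y. ereal (- a * norm (y - x))) \<longlongrightarrow> ereal (- a * norm (x - x))) (at x)"
    by (intro tendsto_intros)
  then have "Liminf (at x) (\<lambda>y. ereal (- a * norm (y - x))) = ereal (- a * norm (x - x))"
    by (intro lim_imp_Liminf) auto
  then have "0 = Liminf (at x) (\<lambda>y. ereal (- a * norm (y - x)))"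
    by (simp add: zero_ereal_def)
  also have "\<dots> \<le> Liminf (at x) (\<lambda>y. (restrict_to S \<phi> y - restrict_to S \<phi> x
      - ereal (v \<bullet> (y - x))) / ereal (norm (y - x)))"
    using bound by (intro Liminf_mono) (auto simp: eventually_at_filter)
  finally show ?thesis
    using x by (simp add: regular_subdiff_def v_def restrict_to_def)
qed

lemma regular_subdiff_subset_limiting: "regular_subdiff f x \<subseteq> limiting_subdiff f x"
proof
  fix v assume v: "v \<in> regular_subdiff f x"
  then have "\<bar>f x\<bar> \<noteq> \<infinity>" by (simp add: regular_subdiff_def)
  with v show "v \<in> limiting_subdiff f x"
    unfolding limiting_subdiff_def
    by (intro CollectI conjI exI[of _ "\<lambda>_. x"] exI[of _ "\<lambda>_. v"]) auto
qed

text \<open>The gap between the two sides is the sum of the squared pairwise differences. This is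
  the origin of the factor 3 in \<open>A\<close> and \<open>B\<close>.\<close>

lemma norm_add3_power2_le:
  "(norm (a + b + c))\<^sup>2 \<le> 3 * ((norm a)\<^sup>2 + (norm b)\<^sup>2 + (norm (c::'a::real_inner))\<^sup>2)"
proof -
  have "0 \<le> (norm (a - b))\<^sup>2 + (norm (b - c))\<^sup>2 + (norm (a - c))\<^sup>2" by simp
  then show ?thesis
    unfolding power2_norm_eq_inner
    by (simp add: inner_diff_left inner_diff_right inner_add_left inner_add_right inner_commute)
qed

subsection \<open>Bellman matrices\<close>

lemma bellman_matrix_component:
  "(bellman_matrix P \<gamma> \<pi> t *v V) $ s
     = V $ s - \<gamma> * (\<Sum>s'\<in>UNIV. (\<Sum>a\<in>UNIV. \<pi> t s a * P s a s') * V $ s')"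
proof -
  have "bellman_matrix P \<gamma> \<pi> t *v V = V - \<gamma> *\<^sub>R (policy_trans P \<pi> t *v V)"
    by (simp add: bellman_matrix_def matrix_vector_mult_diff_rdistrib scaleR_matrix_vector_assoc)
  then show ?thesis by (simp add: policy_trans_def matrix_vector_mult_def)
qed

context
  fixes P :: "'s::finite \<Rightarrow> 'a::finite \<Rightarrow> 's \<Rightarrow> real"
    and \<pi> :: "'t \<Rightarrow> 's \<Rightarrow> 'a \<Rightarrow> real" and t :: 't and \<gamma> :: real
  assumes P: "transition_kernel P"
    and \<pi>: "\<And>s a. 0 \<le> \<pi> t s a" "\<And>s. (\<Sum>a\<in>UNIV. \<pi> t s a) = 1"
    and \<gamma>: "0 < \<gamma>" "\<gamma> < 1"
begin

text \<open>The inner sums form a probability vector in s': the law of the next state when the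
  action is drawn from the policy.\<close>

lemma policy_average_le:
  assumes "\<And>s'. \<bar>V $ s'\<bar> \<le> b"
  shows "\<bar>\<Sum>s'\<in>UNIV. (\<Sum>a\<in>UNIV. \<pi> t s a * P s a s') * V $ s'\<bar> \<le> b"
proof -
  let ?w = "\<lambda>s'. \<Sum>a\<in>UNIV. \<pi> t s a * P s a s'"
  have w: "0 \<le> ?w s'" for s'
    using P \<pi> by (intro sum_nonneg mult_nonneg_nonneg) (auto simp: transition_kernel_def)
  have "(\<Sum>s'\<in>UNIV. ?w s') = (\<Sum>a\<in>UNIV. \<pi> t s a * (\<Sum>s'\<in>UNIV. P s a s'))"
    by (subst sum.swap) (simp add: sum_distrib_left)
  also have "\<dots> = 1" using P \<pi> by (simp add: transition_kernel_def)
  finally have w1: "(\<Sum>s'\<in>UNIV. ?w s') = 1" .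
  have "\<bar>\<Sum>s'\<in>UNIV. ?w s' * V $ s'\<bar> \<le> (\<Sum>s'\<in>UNIV. ?w s' * b)"
    using w assms by (intro order_trans[OF sum_abs] sum_mono) (simp add: abs_mult mult_left_mono)
  also have "\<dots> = b" using w1 by (simp flip: sum_distrib_right)
  finally show ?thesis .
qed

text \<open>At a coordinate where V has its largest modulus b, the discounted average cancels at
  most \<gamma> b, so the image has modulus at least (1 - \<gamma>) b there. Bounding the Euclidean
  norm by the sum of the coordinates costs the factor \<open>CARD('s)\<close>; what matters is that
  the constant does not depend on t.\<close>

lemma norm_le_bellman_matrix:
  "norm V \<le> real CARD('s) / (1 - \<gamma>) * norm (bellman_matrix P \<gamma> \<pi> t *v V)"
proof -
  define b where "b = Max (range (\<lambda>s. \<bar>V $ s\<bar>))"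
  have "b \<in> range (\<lambda>s. \<bar>V $ s\<bar>)" unfolding b_def by (intro Max_in) auto
  then obtain s where s: "b = \<bar>V $ s\<bar>" by auto
  have b: "\<bar>V $ s'\<bar> \<le> b" for s' unfolding b_def by (intro Max_ge) auto
  let ?W = "bellman_matrix P \<gamma> \<pi> t *v V"
  have "\<bar>\<gamma> * (\<Sum>s'\<in>UNIV. (\<Sum>a\<in>UNIV. \<pi> t s a * P s a s') * V $ s')\<bar> \<le> \<gamma> * b"
    using policy_average_le[OF b] \<gamma> by (simp add: abs_mult)
  then have "(1 - \<gamma>) * b \<le> \<bar>?W $ s\<bar>"
    using s unfolding bellman_matrix_component by (simp add: algebra_simps)
  also have "\<dots> \<le> norm ?W" by (rule component_le_norm_cart)
  finally have "b \<le> norm ?W / (1 - \<gamma>)" using \<gamma> by (simp add: field_simps)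
  moreover have "norm V \<le> (\<Sum>s'\<in>UNIV. \<bar>V $ s'\<bar>)" by (rule norm_le_l1_cart)
  moreover have "(\<Sum>s'\<in>UNIV. \<bar>V $ s'\<bar>) \<le> real CARD('s) * b"
    using b by (simp add: sum_bounded_above)
  ultimately have "norm V \<le> real CARD('s) * (norm ?W / (1 - \<gamma>))"
    using mult_left_mono[of b _ "real CARD('s)"] by fastforce
  then show ?thesis by simp
qed

lemma spectral_norm_bellman_matrix_le:
  "spectral_norm (bellman_matrix P \<gamma> \<pi> t) \<le> 2 * real CARD('s)"
proof (rule spectral_norm_le)
  fix V
  have "\<bar>(bellman_matrix P \<gamma> \<pi> t *v V) $ s\<bar> \<le> 2 * norm V" for s
  proof -
    have "\<bar>\<gamma> * (\<Sum>s'\<in>UNIV. (\<Sum>a\<in>UNIV. \<pi> t s a * P s a s') * V $ s')\<bar> \<le> 1 * norm V"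
      using policy_average_le[of V "norm V" s] \<gamma> component_le_norm_cart[of V]
      unfolding abs_mult by (intro mult_mono) auto
    then show ?thesis
      using component_le_norm_cart[of V s] unfolding bellman_matrix_component by linarith
  qed
  then have "(\<Sum>s\<in>UNIV. \<bar>(bellman_matrix P \<gamma> \<pi> t *v V) $ s\<bar>) \<le> real CARD('s) * (2 * norm V)"
    by (simp add: sum_bounded_above)
  then show "norm (bellman_matrix P \<gamma> \<pi> t *v V) \<le> 2 * real CARD('s) * norm V"
    using norm_le_l1_cart[of "bellman_matrix P \<gamma> \<pi> t *v V"] by simp
qed

lemma bellman_matrix_inverse:
  "matrix_inv (bellman_matrix P \<gamma> \<pi> t) ** bellman_matrix P \<gamma> \<pi> t = mat 1"
  "bellman_matrix P \<gamma> \<pi> t ** matrix_inv (bellman_matrix P \<gamma> \<pi> t) = mat 1"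
proof -
  have "V = 0" if "bellman_matrix P \<gamma> \<pi> t *v V = 0" for V
    using norm_le_bellman_matrix[of V] that by simp
  then show "matrix_inv (bellman_matrix P \<gamma> \<pi> t) ** bellman_matrix P \<gamma> \<pi> t = mat 1"
    and "bellman_matrix P \<gamma> \<pi> t ** matrix_inv (bellman_matrix P \<gamma> \<pi> t) = mat 1"
    by (blast intro: matrix_inv_cancel)+
qed

lemma spectral_norm_bellman_inverse_le:
  "spectral_norm (matrix_inv (bellman_matrix P \<gamma> \<pi> t)) \<le> real CARD('s) / (1 - \<gamma>)"
proof (rule spectral_norm_le)
  fix W
  show "norm (matrix_inv (bellman_matrix P \<gamma> \<pi> t) *v W) \<le> real CARD('s) / (1 - \<gamma>) * norm W"
    using norm_le_bellman_matrix[of "matrix_inv (bellman_matrix P \<gamma> \<pi> t) *v W"]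
    by (simp add: matrix_vector_mul_assoc bellman_matrix_inverse)
qed

lemma norm_policy_reward_le:
  "norm (policy_reward r \<pi> t) \<le> (\<Sum>s\<in>UNIV. \<Sum>a\<in>UNIV. \<bar>r s a\<bar>)"
proof -
  have le1: "\<pi> t s a \<le> 1" for s a
    using member_le_sum[of a UNIV "\<pi> t s"] \<pi> by simp
  have "\<bar>policy_reward r \<pi> t $ s\<bar> \<le> (\<Sum>a\<in>UNIV. \<bar>r s a\<bar>)" for s
    unfolding policy_reward_def vec_lambda_beta
    using \<pi> le1 by (intro order_trans[OF sum_abs] sum_mono) (simp add: abs_mult mult_left_le_one_le)
  then show ?thesis
    by (intro order_trans[OF norm_le_l1_cart] sum_mono) simp
qed

end

section \<open>Differentiability of the Bellman data and perturbation of adjoints\<close>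

text \<open>The vector is a finite sum of the linear embeddings \<open>axis i\<close> applied to its
  coordinates. The general coordinate type allows a second application to the rows of a
  matrix.\<close>

lemma differentiable_vec_lambda:
  fixes f :: "'x::real_normed_vector \<Rightarrow> 'n::finite \<Rightarrow> 'b::euclidean_space"
  assumes "\<And>i. (\<lambda>x. f x i) differentiable (at z)"
  shows "(\<lambda>x. \<chi> i. f x i) differentiable (at z)"
proof -
  have lin: "bounded_linear (axis i :: 'b \<Rightarrow> 'b^'n)" for i
    unfolding linear_conv_bounded_linear[symmetric]
    by (rule linearI) (auto simp: axis_def vec_eq_iff)
  have eq: "(\<lambda>x. \<chi> i. f x i) = (\<lambda>x. \<Sum>i\<in>UNIV. axis i (f x i))"
    by (auto simp: vec_eq_iff axis_def if_distrib cong: if_cong)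
  have "(\<lambda>x. axis i (f x i)) differentiable (at z)" for i
    using assms[of i] bounded_linear.has_derivative[OF lin[of i]]
    unfolding differentiable_def by blast
  then show ?thesis unfolding eq by (intro differentiable_sum) auto
qed

lemma differentiable_bellman_matrix:
  assumes "\<And>s a. (\<lambda>t. \<pi> t s a) differentiable (at x)"
  shows "bellman_matrix P \<gamma> \<pi> differentiable (at x)"
proof -
  have "(\<lambda>t. \<chi> s s'. \<Sum>a\<in>UNIV. \<pi> t s a * P s a s') differentiable (at x)"
    using assms by (intro differentiable_vec_lambda differentiable_sum ballI differentiable_mult) auto
  then have "(\<lambda>t. \<gamma> *\<^sub>R (\<chi> s s'. \<Sum>a\<in>UNIV. \<pi> t s a * P s a s')) differentiable (at x)"
    by (intro differentiable_scaleR) auto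
  then show ?thesis
    unfolding bellman_matrix_def policy_trans_def by (intro differentiable_diff) auto
qed

lemma differentiable_policy_reward:
  assumes "\<And>s a. (\<lambda>t. \<pi> t s a) differentiable (at x)"
  shows "policy_reward r \<pi> differentiable (at x)"
  unfolding policy_reward_def
  using assms by (intro differentiable_vec_lambda differentiable_sum ballI differentiable_mult) auto

text \<open>Pair the difference z with itself and move both adjoints across: the result splits into
  f z - g z against x and g z against x - y. It serves to compare transposed Jacobians at two values
  of V acting on two multipliers.\<close>

lemma adjoint_diff_norm_le:
  fixes f g :: "'a::euclidean_space \<Rightarrow> 'b::euclidean_space"
  assumes lin: "linear f" "linear g"
    and nonneg: "0 \<le> a" "0 \<le> b"
    and diff: "\<And>u. norm (f u - g u) \<le> a * norm u"
    and g: "\<And>u. norm (g u) \<le> b * norm u"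
  shows "norm (adjoint f x - adjoint g y) \<le> a * norm x + b * norm (x - y)"
proof -
  define z where "z = adjoint f x - adjoint g y"
  have "norm z * norm z = z \<bullet> z"
    by (simp add: dot_square_norm power2_eq_square)
  also have "\<dots> = (f z - g z) \<bullet> x + g z \<bullet> (x - y)"
    using adjoint_works[OF lin(1), of z x] adjoint_works[OF lin(2), of z y]
    by (simp add: z_def[symmetric] inner_diff_left inner_diff_right)
       (simp add: z_def inner_diff_right)
  also have "\<dots> \<le> norm (f z - g z) * norm x + norm (g z) * norm (x - y)"
    by (intro add_mono norm_cauchy_schwarz)
  also have "\<dots> \<le> (a * norm z) * norm x + (b * norm z) * norm (x - y)"
    by (intro add_mono mult_right_mono diff g) auto
  also have "\<dots> = (a * norm x + b * norm (x - y)) * norm z"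
    by (simp add: algebra_simps)
  finally have *: "norm z * norm z \<le> (a * norm x + b * norm (x - y)) * norm z" .
  show ?thesis
  proof (cases "z = 0")
    case True
    then show ?thesis using nonneg by (simp add: z_def[symmetric])
  next
    case False
    then show ?thesis using * by (simp add: z_def)
  qed
qed

lemma bounded_linear_matrix_vector_mult_left:
  "bounded_linear (\<lambda>A :: real^'n^'m. A *v x)"
  unfolding linear_conv_bounded_linear[symmetric]
  by (rule linearI) (simp_all add: matrix_vector_mult_add_rdistrib scaleR_matrix_vector_assoc)

subsection \<open>Runs of the Bellman-ADMM\<close>

text \<open>The decision process enters only as a residual affine in V, with \<open>\<rho>\<close>
  in the place of the reward and with bounds on \<open>M\<close>, its inverse and
  \<open>\<rho>\<close> that are uniform on \<Theta>. The number \<open>m\<close> is a lower bound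
  of the reduced objective.\<close>

locale bellman_admm_run =
  fixes \<phi> :: "real^'p \<Rightarrow> ereal" and \<Theta> :: "(real^'p) set" and c :: "real^'s"
    and M :: "real^'p \<Rightarrow> real^'s^'s" and \<rho> :: "real^'p \<Rightarrow> real^'s"
    and R :: "real^'p \<Rightarrow> real^'s \<Rightarrow> real^'s"
    and \<beta> \<eta>V :: real and \<eta> L :: "nat \<Rightarrow> real"
    and \<theta> :: "nat \<Rightarrow> real^'p" and V l :: "nat \<Rightarrow> real^'s"
    and \<kappa> L\<^sub>M K\<^sub>M K\<^sub>r m \<tau> \<eta>low Lbar \<alpha> B\<^sub>M B\<^sub>r A B :: real
  assumes R_eq: "R = (\<lambda>t W. M t *v W - \<rho> t)"
    and differentiable: "t \<in> \<Theta> \<Longrightarrow> M differentiable (at t)" "t \<in> \<Theta> \<Longrightarrow> \<rho> differentiable (at t)"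
    and inverse: "t \<in> \<Theta> \<Longrightarrow> matrix_inv (M t) ** M t = mat 1"
        "t \<in> \<Theta> \<Longrightarrow> M t ** matrix_inv (M t) = mat 1"
    and kappa: "t \<in> \<Theta> \<Longrightarrow> spectral_norm (matrix_inv (M t)) \<le> \<kappa>"
    and M_bound: "t \<in> \<Theta> \<Longrightarrow> spectral_norm (M t) \<le> K\<^sub>M"
    and \<rho>_bound: "t \<in> \<Theta> \<Longrightarrow> norm (\<rho> t) \<le> K\<^sub>r"
    and convex: "convex \<Theta>"
    and proper: "t \<in> \<Theta> \<Longrightarrow> \<phi> t \<noteq> -\<infinity>"
    and M_lipschitz: "t \<in> \<Theta> \<Longrightarrow> t' \<in> \<Theta> \<Longrightarrow> spectral_norm (M t - M t') \<le> L\<^sub>M * norm (t - t')"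
    and reduced: "t \<in> \<Theta> \<Longrightarrow> ereal m \<le> \<phi> t + ereal (c \<bullet> (matrix_inv (M t) *v \<rho> t))"
    and params: "0 < \<beta>" "0 < \<eta>V" "0 < \<eta> k"
    and algorithm: "bellman_admm \<phi> \<Theta> c R \<beta> \<eta>V \<eta> \<theta> V l"
    and A_eq: "A = 3 * \<kappa> ^ 4 * L\<^sub>M\<^sup>2 * (norm c)\<^sup>2"
    and B_eq: "B = 3 * \<kappa>\<^sup>2 / \<eta>V\<^sup>2"
    and tau: "B / \<beta> < \<tau>" "\<tau> < 1 / (2 * \<eta>V) - B / \<beta>"
    and DM_bounded: "spectral_norm (frechet_derivative M (at (\<theta> k)) u) \<le> B\<^sub>M * norm u"
    and D\<rho>_bounded: "norm (frechet_derivative \<rho> (at (\<theta> k)) u) \<le> B\<^sub>r * norm u"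
    and h_lipschitz: "(L k)-lipschitz_on (closed_segment (\<theta> k) (\<theta> (Suc k)))
        (grad (penalty R \<beta> (V k) (l k)))"
    and step_lower: "0 < \<eta>low" "\<eta>low \<le> \<eta> k"
    and L_upper: "L k \<le> Lbar"
    and step_cond: "0 < \<alpha>" "\<alpha> \<le> 1 / (2 * \<eta> k) - L k / 2 - A / \<beta>"
begin

abbreviation (input) N where "N t \<equiv> matrix_inv (M t)"
abbreviation (input) DR where "DR t W \<equiv> frechet_derivative (\<lambda>t. R t W) (at t)"

text \<open>\<open>real_of_ereal\<close> sends infinite values to 0, so \<open>p\<close> is
  meaningful only through \<open>phi_theta\<close>, which shows that \<phi> is finite at every
  iterate.\<close>

definition p :: "nat \<Rightarrow> real" where "p k = real_of_ereal (\<phi> (\<theta> k))"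

text \<open>Indices are shifted: \<open>S n\<close> and \<open>lyap n\<close> below belong to the paper's \<open>k = n + 1\<close>.\<close>
definition S :: "nat \<Rightarrow> real" where
  "S n = (norm (\<theta> (Suc (Suc n)) - \<theta> (Suc n)))\<^sup>2 + (norm (V (Suc (Suc n)) - V (Suc n)))\<^sup>2
       + (norm (V (Suc n) - V n))\<^sup>2"

text \<open>The augmented Lagrangian along the run, as a real number.\<close>

definition merit :: "nat \<Rightarrow> real" where
  "merit k = p k + (c \<bullet> V k + l k \<bullet> R (\<theta> k) (V k) + \<beta> / 2 * (norm (R (\<theta> k) (V k)))\<^sup>2)"

lemma kappa_nonneg: "t \<in> \<Theta> \<Longrightarrow> 0 \<le> \<kappa>"
  using kappa spectral_norm_nonneg order_trans by blast

lemma theta_min: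
  "\<theta> (Suc k) \<in> \<Theta>"
  "t \<in> \<Theta> \<Longrightarrow>
    \<phi> (\<theta> (Suc k)) + ereal (grad (penalty R \<beta> (V k) (l k)) (\<theta> k) \<bullet> (\<theta> (Suc k) - \<theta> k)
        + 1 / (2 * \<eta> k) * (norm (\<theta> (Suc k) - \<theta> k))\<^sup>2)
    \<le> \<phi> t + ereal (grad (penalty R \<beta> (V k) (l k)) (\<theta> k) \<bullet> (t - \<theta> k)
        + 1 / (2 * \<eta> k) * (norm (t - \<theta> k))\<^sup>2)"
  using algorithm unfolding bellman_admm_def is_arg_min_linorder by blast+

lemma V_min:
  "aug_lagrangian \<phi> c R \<beta> (\<theta> (Suc k)) (V (Suc k)) (l k)
      + ereal (1 / (2 * \<eta>V) * (norm (V (Suc k) - V k))\<^sup>2)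
    \<le> aug_lagrangian \<phi> c R \<beta> (\<theta> (Suc k)) W (l k)
      + ereal (1 / (2 * \<eta>V) * (norm (W - V k))\<^sup>2)"
  using algorithm unfolding bellman_admm_def is_arg_min_linorder by blast

lemma l_update: "l (Suc k) = l k + \<beta> *\<^sub>R R (\<theta> (Suc k)) (V (Suc k))"
  using algorithm unfolding bellman_admm_def by blast

text \<open>Finiteness propagates: the previous iterate is itself a competitor in the \<theta>-step,
  with a finite value.\<close>

lemma theta_feasible: "\<theta> k \<in> \<Theta> \<and> \<phi> (\<theta> k) \<noteq> \<infinity>"
proof (induction k)
  case 0
  then show ?case
    using algorithm by (auto simp: bellman_admm_def restrict_to_def split: if_splits)
next
  case (Suc k)
  then show ?case using theta_min[where k=k] theta_min(2)[of "\<theta> k" k] by auto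
qed

lemma theta_in [simp]: "\<theta> k \<in> \<Theta>"
  using theta_feasible by blast

lemma phi_theta: "\<phi> (\<theta> k) = ereal (p k)"
  using theta_feasible[of k] proper[of "\<theta> k"] by (cases "\<phi> (\<theta> k)") (auto simp: p_def)

lemma aug_lagrangian_eq:
  "aug_lagrangian \<phi> c R \<beta> (\<theta> k) W x
     = ereal (p k + (c \<bullet> W + x \<bullet> R (\<theta> k) W + \<beta> / 2 * (norm (R (\<theta> k) W))\<^sup>2))"
  by (simp add: aug_lagrangian_def phi_theta)

lemma R_has_derivative:
  assumes "t \<in> \<Theta>"
  shows "((\<lambda>t. R t W) has_derivative
    (\<lambda>u. frechet_derivative M (at t) u *v W - frechet_derivative \<rho> (at t) u)) (at t)"
  unfolding R_eq
  using differentiable[OF assms] unfolding frechet_derivative_works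
  by (intro has_derivative_diff
      bounded_linear.has_derivative[OF bounded_linear_matrix_vector_mult_left]) auto

lemma DR_eq:
  "t \<in> \<Theta> \<Longrightarrow> DR t W = (\<lambda>u. frechet_derivative M (at t) u *v W - frechet_derivative \<rho> (at t) u)"
  by (rule frechet_derivative_at[OF R_has_derivative, symmetric])

lemma linear_DR: "t \<in> \<Theta> \<Longrightarrow> linear (DR t W)"
  by (subst DR_eq, assumption) (rule has_derivative_linear[OF R_has_derivative])

lemma GDERIV_penalty:
  assumes t: "t \<in> \<Theta>"
  shows "GDERIV (penalty R \<beta> W x) t :> adjoint (DR t W) (x + \<beta> *\<^sub>R R t W)"
proof -
  have R: "((\<lambda>t. R t W) has_derivative DR t W) (at t)"
    using R_has_derivative[OF t] DR_eq[OF t] by simp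
  have "(penalty R \<beta> W x has_derivative (\<lambda>u. x \<bullet> DR t W u
      + \<beta> / 2 * (R t W \<bullet> DR t W u + DR t W u \<bullet> R t W))) (at t)"
    unfolding penalty_def power2_norm_eq_inner
    by (intro has_derivative_add has_derivative_inner_right has_derivative_mult_right
        has_derivative_inner R)
  moreover have "x \<bullet> DR t W u + \<beta> / 2 * (R t W \<bullet> DR t W u + DR t W u \<bullet> R t W)
      = u \<bullet> adjoint (DR t W) (x + \<beta> *\<^sub>R R t W)" for u
    unfolding adjoint_works[OF linear_DR[OF t]]
    by (simp add: inner_add_left inner_add_right inner_commute)
  ultimately show ?thesis unfolding gderiv_def by simp
qed

lemma grad_penalty: "t \<in> \<Theta> \<Longrightarrow> grad (penalty R \<beta> W x) t = adjoint (DR t W) (x + \<beta> *\<^sub>R R t W)"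
  by (intro grad_eq GDERIV_penalty)

lemma V_stationary:
  "c + l (Suc k) v* M (\<theta> (Suc k)) + (1 / \<eta>V) *\<^sub>R (V (Suc k) - V k) = 0"
proof -
  let ?t = "\<theta> (Suc k)"
  define F where "F W = c \<bullet> W + l k \<bullet> R ?t W + \<beta> / 2 * (R ?t W \<bullet> R ?t W)
      + 1 / (2 * \<eta>V) * ((W - V k) \<bullet> (W - V k))" for W
  let ?x = "V (Suc k)"
  have min: "F ?x \<le> F W" for W
    using V_min[of k W] by (simp add: aug_lagrangian_eq F_def power2_norm_eq_inner)
  have R: "((\<lambda>W. R ?t W) has_derivative (\<lambda>h. M ?t *v h)) (at ?x)"
    unfolding R_eq
    by (auto intro!: derivative_eq_intros bounded_linear_imp_has_derivative)
  have "(F has_derivative (\<lambda>h. c \<bullet> h + l k \<bullet> (M ?t *v h)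
      + \<beta> / 2 * (R ?t ?x \<bullet> (M ?t *v h) + (M ?t *v h) \<bullet> R ?t ?x)
      + 1 / (2 * \<eta>V) * ((?x - V k) \<bullet> (h - 0) + (h - 0) \<bullet> (?x - V k)))) (at ?x)"
    unfolding F_def
    by (intro has_derivative_add has_derivative_inner_right has_derivative_mult_right
        has_derivative_inner has_derivative_diff has_derivative_const has_derivative_ident R)
  moreover have "c \<bullet> h + l k \<bullet> (M ?t *v h)
      + \<beta> / 2 * (R ?t ?x \<bullet> (M ?t *v h) + (M ?t *v h) \<bullet> R ?t ?x)
      + 1 / (2 * \<eta>V) * ((?x - V k) \<bullet> (h - 0) + (h - 0) \<bullet> (?x - V k))
      = h \<bullet> (c + l (Suc k) v* M ?t + (1 / \<eta>V) *\<^sub>R (?x - V k))" for h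
  proof -
    have "h \<bullet> (l (Suc k) v* M ?t) = l (Suc k) \<bullet> (M ?t *v h)"
      by (metis dot_lmul_matrix inner_commute)
    then show ?thesis
      unfolding l_update by (simp add: inner_add_left inner_add_right inner_commute)
  qed
  ultimately have "GDERIV F ?x :> c + l (Suc k) v* M ?t + (1 / \<eta>V) *\<^sub>R (?x - V k)"
    unfolding gderiv_def by simp
  then show ?thesis using min by (rule GDERIV_minimum_zero)
qed

lemma l_eq:
  "l (Suc k) = - ((c + (1 / \<eta>V) *\<^sub>R (V (Suc k) - V k)) v* N (\<theta> (Suc k)))"
proof -
  let ?t = "\<theta> (Suc k)"
  have "l (Suc k) = (l (Suc k) v* M ?t) v* N ?t"
    by (simp add: vector_matrix_mul_assoc inverse)
  also have "l (Suc k) v* M ?t = (-1) *\<^sub>R (c + (1 / \<eta>V) *\<^sub>R (V (Suc k) - V k))"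
    using V_stationary[of k] by (simp add: algebra_simps eq_neg_iff_add_eq_0)
  finally show ?thesis unfolding scaleR_vector_matrix_assoc by simp
qed

lemma norm_vector_N_le: "t \<in> \<Theta> \<Longrightarrow> norm (x v* N t) \<le> \<kappa> * norm x"
  by (meson kappa norm_vector_matrix_mult_le mult_right_mono norm_ge_zero order_trans)

section \<open>Sufficient decrease and lower bound of the Lyapunov function\<close>

text \<open>Subtracting two instances of \<open>l_eq\<close> leaves three terms: the change of the
  inverse acting on c, the new V-increment and the old one. Only c meets the change of the inverse,
  so \<open>A\<close> contains \<open>norm c\<close> and no bound on V. As \<open>l_eq\<close> says
  nothing about \<open>l 0\<close>, the indices start at 1.\<close>

lemma multiplier_increment:
  "(norm (l (Suc (Suc n)) - l (Suc n)))\<^sup>2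
     \<le> A * (norm (\<theta> (Suc (Suc n)) - \<theta> (Suc n)))\<^sup>2
       + B * ((norm (V (Suc (Suc n)) - V (Suc n)))\<^sup>2 + (norm (V (Suc n) - V n))\<^sup>2)"
proof -
  let ?t = "\<theta> (Suc (Suc n))" and ?s = "\<theta> (Suc n)"
  define dt where "dt = norm (?t - ?s)"
  define d' where "d' = V (Suc (Suc n)) - V (Suc n)"
  define d where "d = V (Suc n) - V n"
  note k0 = kappa_nonneg[OF theta_in]
  define a where "a = - (((c v* N ?t) v* (M ?s - M ?t)) v* N ?s)"
  define b' where "b' = - ((1 / \<eta>V) *\<^sub>R (d' v* N ?t))"
  define b where "b = (1 / \<eta>V) *\<^sub>R (d v* N ?s)"
  \<comment> \<open>The resolvent identity: with N the inverse of M, N(t) - N(s) = N(t) (M(s) -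
    M(t)) N(s).\<close>
  have resolvent: "c v* N ?t - c v* N ?s = - a"
    by (simp add: a_def vector_matrix_mult_diff_rdistrib vector_matrix_mult_diff_distrib
        vector_matrix_mul_assoc inverse flip: matrix_mul_assoc)
  have eq: "l (Suc (Suc n)) - l (Suc n) = a + b' + b"
    using resolvent
    unfolding l_eq b_def b'_def d_def[symmetric] d'_def[symmetric] vector_matrix_left_distrib
      scaleR_vector_matrix_assoc
    by (simp add: algebra_simps)
  have "norm a \<le> \<kappa> * (L\<^sub>M * dt * (\<kappa> * norm c))"
  proof -
    have "norm a \<le> \<kappa> * norm ((c v* N ?t) v* (M ?s - M ?t))"
      unfolding a_def norm_minus_cancel by (intro norm_vector_N_le) simp
    also have "norm ((c v* N ?t) v* (M ?s - M ?t)) \<le> spectral_norm (M ?s - M ?t) * norm (c v* N ?t)"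
      by (rule norm_vector_matrix_mult_le)
    also have "\<dots> \<le> (L\<^sub>M * norm (?s - ?t)) * (\<kappa> * norm c)"
      using M_lipschitz[of ?s ?t] spectral_norm_nonneg[of "M ?s - M ?t"]
      by (intro mult_mono norm_vector_N_le) auto
    finally show ?thesis using k0 by (simp add: mult_left_mono dt_def norm_minus_commute)
  qed
  then have "(norm a)\<^sup>2 \<le> (\<kappa> * (L\<^sub>M * dt * (\<kappa> * norm c)))\<^sup>2" by (rule power_mono) simp
  moreover have "norm b' \<le> 1 / \<eta>V * (\<kappa> * norm d')"
    using params norm_vector_N_le[of ?t d'] by (simp add: b'_def divide_right_mono)
  then have "(norm b')\<^sup>2 \<le> (1 / \<eta>V * (\<kappa> * norm d'))\<^sup>2"
    by (rule power_mono) simp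
  moreover have "norm b \<le> 1 / \<eta>V * (\<kappa> * norm d)"
    using params norm_vector_N_le[of ?s d] by (simp add: b_def divide_right_mono)
  then have "(norm b)\<^sup>2 \<le> (1 / \<eta>V * (\<kappa> * norm d))\<^sup>2"
    by (rule power_mono) simp
  ultimately have "(norm (l (Suc (Suc n)) - l (Suc n)))\<^sup>2 \<le>
      3 * ((\<kappa> * (L\<^sub>M * dt * (\<kappa> * norm c)))\<^sup>2 + (1 / \<eta>V * (\<kappa> * norm d'))\<^sup>2
        + (1 / \<eta>V * (\<kappa> * norm d))\<^sup>2)"
    unfolding eq by (intro order_trans[OF norm_add3_power2_le] mult_left_mono add_mono) auto
  also have "\<dots> = A * dt\<^sup>2 + B * ((norm d')\<^sup>2 + (norm d)\<^sup>2)"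
    unfolding A_eq B_eq
    by (simp add: power_mult_distrib power_divide algebra_simps eval_nat_numeral add_divide_distrib)
  finally show ?thesis by (simp add: dt_def d_def d'_def)
qed

text \<open>Each update contributes one estimate: the \<theta>-step by the descent inequality and
  comparison with the old \<theta>, the V-step by comparison with the old V, and the multiplier step
  by an exact increase, the only term with the wrong sign.\<close>

lemma merit_step:
  "merit (Suc k) \<le> merit k - (1 / (2 * \<eta> k) - L k / 2) * (norm (\<theta> (Suc k) - \<theta> k))\<^sup>2
     - 1 / (2 * \<eta>V) * (norm (V (Suc k) - V k))\<^sup>2 + (norm (l (Suc k) - l k))\<^sup>2 / \<beta>"
proof -
  let ?h = "penalty R \<beta> (V k) (l k)"
  \<comment> \<open>The gradient formula for the penalty holds on \<Theta>, so the whole comparison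
    segment has to lie there.\<close>
  have seg: "closed_segment (\<theta> k) (\<theta> (Suc k)) \<subseteq> \<Theta>"
    using convex by (simp add: closed_segment_subset)
  have "?h (\<theta> (Suc k)) \<le> ?h (\<theta> k) + grad ?h (\<theta> k) \<bullet> (\<theta> (Suc k) - \<theta> k)
      + L k / 2 * (norm (\<theta> (Suc k) - \<theta> k))\<^sup>2"
  proof (rule descent_inequality[OF _ h_lipschitz])
    fix z assume "z \<in> closed_segment (\<theta> k) (\<theta> (Suc k))"
    then have "z \<in> \<Theta>" using seg by blast
    then show "GDERIV ?h z :> grad ?h z" using GDERIV_penalty grad_penalty by simp
  qed
  moreover have "p (Suc k) + (grad ?h (\<theta> k) \<bullet> (\<theta> (Suc k) - \<theta> k)
      + 1 / (2 * \<eta> k) * (norm (\<theta> (Suc k) - \<theta> k))\<^sup>2) \<le> p k"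
    using theta_min(2)[of "\<theta> k" k] by (simp add: phi_theta)
  moreover have "c \<bullet> V (Suc k) + l k \<bullet> R (\<theta> (Suc k)) (V (Suc k))
      + \<beta> / 2 * (norm (R (\<theta> (Suc k)) (V (Suc k))))\<^sup>2 + 1 / (2 * \<eta>V) * (norm (V (Suc k) - V k))\<^sup>2
      \<le> c \<bullet> V k + l k \<bullet> R (\<theta> (Suc k)) (V k) + \<beta> / 2 * (norm (R (\<theta> (Suc k)) (V k)))\<^sup>2"
    using V_min[of k "V k"] by (simp add: aug_lagrangian_eq)
  moreover have "l (Suc k) \<bullet> R (\<theta> (Suc k)) (V (Suc k))
      = l k \<bullet> R (\<theta> (Suc k)) (V (Suc k)) + (norm (l (Suc k) - l k))\<^sup>2 / \<beta>"
    using params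
    by (simp add: l_update inner_add_left dot_square_norm power_mult_distrib power2_eq_square)
  ultimately show ?thesis
    unfolding merit_def penalty_def by (simp add: algebra_simps)
qed

definition lyap :: "nat \<Rightarrow> real" where
  "lyap n = merit (Suc n) + \<tau> * (norm (V (Suc n) - V n))\<^sup>2"

text \<open>The least of the three coefficients that survive once the multiplier term is charged to
  the primal increments: \<tau> is paid on the new V-increment and returned on the old one.\<close>

definition \<delta> :: real where
  "\<delta> = min \<alpha> (min (1 / (2 * \<eta>V) - B / \<beta> - \<tau>) (\<tau> - B / \<beta>))"

lemma delta_pos: "0 < \<delta>"
  using step_cond tau by (simp add: \<delta>_def)

lemma lyap_step: "lyap (Suc n) \<le> lyap n - \<delta> * S n"
proof -
  let ?x = "(norm (\<theta> (Suc (Suc n)) - \<theta> (Suc n)))\<^sup>2"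
  let ?y = "(norm (V (Suc (Suc n)) - V (Suc n)))\<^sup>2"
  let ?z = "(norm (V (Suc n) - V n))\<^sup>2"
  have "(norm (l (Suc (Suc n)) - l (Suc n)))\<^sup>2 / \<beta> \<le> (A * ?x + B * (?y + ?z)) / \<beta>"
    using multiplier_increment params by (intro divide_right_mono) auto
  also have "\<dots> = A / \<beta> * ?x + B / \<beta> * ?y + B / \<beta> * ?z"
    by (simp add: add_divide_distrib distrib_left)
  finally have "lyap (Suc n) \<le> lyap n
      - (1 / (2 * \<eta> (Suc n)) - L (Suc n) / 2 - A / \<beta>) * ?x
      - (1 / (2 * \<eta>V) - B / \<beta> - \<tau>) * ?y - (\<tau> - B / \<beta>) * ?z"
    using merit_step[of "Suc n"] unfolding lyap_def by (simp add: algebra_simps)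
  moreover have "\<delta> * ?x \<le> (1 / (2 * \<eta> (Suc n)) - L (Suc n) / 2 - A / \<beta>) * ?x"
    using step_cond(2)[of "Suc n"] by (intro mult_right_mono) (auto simp: \<delta>_def)
  moreover have "\<delta> * ?y \<le> (1 / (2 * \<eta>V) - B / \<beta> - \<tau>) * ?y"
    by (intro mult_right_mono) (auto simp: \<delta>_def)
  moreover have "\<delta> * ?z \<le> (\<tau> - B / \<beta>) * ?z"
    by (intro mult_right_mono) (auto simp: \<delta>_def)
  ultimately show ?thesis by (simp add: S_def distrib_left)
qed

text \<open>Writing V as the inverse applied to e plus \<open>\<rho>\<close>, the contributions of c
  paired with the image of e cancel. Beyond the reduced objective there remains one product of d and
  e, which the penalty and the \<tau>-term absorb together.\<close>

lemma lyap_lower: "m \<le> lyap n"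
proof -
  let ?t = "\<theta> (Suc n)"
  define d where "d = V (Suc n) - V n"
  define e where "e = R ?t (V (Suc n))"
  have V: "V (Suc n) = N ?t *v e + N ?t *v \<rho> ?t"
    by (simp add: e_def R_eq matrix_vector_mult_diff_distrib matrix_vector_mul_assoc inverse)
  have "l (Suc n) \<bullet> e = - ((c + (1 / \<eta>V) *\<^sub>R d) \<bullet> (N ?t *v e))"
    unfolding l_eq d_def[symmetric] by (simp add: dot_lmul_matrix)
  then have "c \<bullet> V (Suc n) + l (Suc n) \<bullet> e
      = c \<bullet> (N ?t *v \<rho> ?t) - 1 / \<eta>V * (d \<bullet> (N ?t *v e))"
    unfolding V by (simp add: inner_add_left inner_add_right)
  moreover have "m \<le> p (Suc n) + c \<bullet> (N ?t *v \<rho> ?t)"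
    using reduced[of ?t] by (simp add: phi_theta)
  moreover have "1 / \<eta>V * (d \<bullet> (N ?t *v e)) \<le> \<beta> / 2 * (norm e)\<^sup>2 + \<tau> * (norm d)\<^sup>2"
  proof -
    have "d \<bullet> (N ?t *v e) \<le> norm d * (\<kappa> * norm e)"
      by (meson norm_cauchy_schwarz norm_matrix_vector_mult_le kappa theta_in mult_left_mono
          mult_right_mono norm_ge_zero order_trans)
    then have "1 / \<eta>V * (d \<bullet> (N ?t *v e)) \<le> 1 / \<eta>V * (norm d * (\<kappa> * norm e))"
      using params by (intro mult_left_mono) auto
    also have "\<dots> = (\<kappa> / \<eta>V * norm d) * norm e" by simp
    \<comment> \<open>Young's inequality, weighted so that the square of e uses exactly the penalty
      term.\<close>
    also have "\<dots> \<le> \<beta> / 2 * (norm e)\<^sup>2 + (\<kappa> / \<eta>V * norm d)\<^sup>2 / (2 * \<beta>)"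
    proof -
      have "0 \<le> (\<beta> * norm e - \<kappa> / \<eta>V * norm d)\<^sup>2 / (2 * \<beta>)" using params by simp
      also have "\<dots> = \<beta> / 2 * (norm e)\<^sup>2 + (\<kappa> / \<eta>V * norm d)\<^sup>2 / (2 * \<beta>)
          - (\<kappa> / \<eta>V * norm d) * norm e"
        using params by (simp add: power2_diff) (simp add: field_simps power2_eq_square)
      finally show ?thesis by simp
    qed
    also have "(\<kappa> / \<eta>V * norm d)\<^sup>2 / (2 * \<beta>) \<le> \<tau> * (norm d)\<^sup>2"
    proof -
      have "(\<kappa> / \<eta>V)\<^sup>2 / (2 * \<beta>) \<le> B / \<beta>"
        unfolding B_eq using params by (simp add: power_divide field_simps)
      then have "(\<kappa> / \<eta>V)\<^sup>2 / (2 * \<beta>) * (norm d)\<^sup>2 \<le> \<tau> * (norm d)\<^sup>2"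
        using tau(1) by (intro mult_right_mono) auto
      then show ?thesis by (simp add: power_mult_distrib power_divide)
    qed
    finally show ?thesis by simp
  qed
  ultimately show ?thesis
    unfolding lyap_def merit_def d_def e_def by linarith
qed

lemma S_nonneg: "0 \<le> S n"
  by (simp add: S_def)

section \<open>Summability of the increments and boundedness of the iterates\<close>

definition K :: real where "K = (lyap 0 - m) / \<delta>"

lemma sum_S_le: "(\<Sum>i<n. S i) \<le> K"
proof -
  have "\<delta> * (\<Sum>i<n. S i) \<le> lyap 0 - lyap n"
  proof (induction n)
    case (Suc n)
    then show ?case using lyap_step[of n] by (simp add: distrib_left)
  qed simp
  then have "(\<Sum>i<n. S i) * \<delta> \<le> lyap 0 - m"
    using lyap_lower[of n] by (simp add: mult.commute)
  then show ?thesis using delta_pos by (simp add: K_def pos_le_divide_eq)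
qed

lemma S_le: "S n \<le> K"
  using sum_S_le[of "Suc n"] sum_nonneg[of "{..<n}" S] S_nonneg by simp

lemma S_tendsto: "S \<longlonglongrightarrow> 0"
  by (intro summable_LIMSEQ_zero summableI_nonneg_bounded[of S K] S_nonneg sum_S_le)

lemma norm_V_diff_le: "norm (V (Suc n) - V n) \<le> 1 + K"
proof -
  let ?x = "norm (V (Suc n) - V n)"
  have "?x\<^sup>2 \<le> S n" by (simp add: S_def)
  \<comment> \<open>This gives x \<le> x^2 + 1/4, a crude bound that avoids square roots in the
    constants.\<close>
  moreover have "0 \<le> (?x - 1 / 2)\<^sup>2" by simp
  then have "?x \<le> 1 + ?x\<^sup>2" by (simp add: power2_diff power_divide)
  ultimately show ?thesis using S_le[of n] by linarith
qed

definition C\<^sub>l :: real where "C\<^sub>l = \<kappa> * (norm c + (1 + K) / \<eta>V)"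

lemma norm_l_le: "norm (l (Suc n)) \<le> C\<^sub>l"
proof -
  have "norm (l (Suc n)) \<le> \<kappa> * norm (c + (1 / \<eta>V) *\<^sub>R (V (Suc n) - V n))"
    unfolding l_eq norm_minus_cancel by (intro norm_vector_N_le) simp
  also have "norm (c + (1 / \<eta>V) *\<^sub>R (V (Suc n) - V n))
      \<le> norm c + norm ((1 / \<eta>V) *\<^sub>R (V (Suc n) - V n))"
    by (rule norm_triangle_ineq)
  also have "norm ((1 / \<eta>V) *\<^sub>R (V (Suc n) - V n)) \<le> (1 + K) / \<eta>V"
    using norm_V_diff_le[of n] params by (simp add: divide_right_mono)
  finally show ?thesis
    using kappa_nonneg[OF theta_in] by (simp add: C\<^sub>l_def mult_left_mono)
qed

text \<open>The first summand covers \<open>V 1\<close>, whose residual involves the arbitrary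
  initial multiplier. Later residuals are multiplier increments divided by \<beta>, each of norm at
  most \<open>2 * C\<^sub>l / \<beta>\<close>.\<close>

definition C\<^sub>V :: real where "C\<^sub>V = norm (V 1) + \<kappa> * (2 * C\<^sub>l / \<beta> + K\<^sub>r)"

lemma norm_V_le: "norm (V (Suc n)) \<le> C\<^sub>V"
proof -
  note k0 = kappa_nonneg[OF theta_in]
  have Cl0: "0 \<le> C\<^sub>l" using norm_l_le norm_ge_zero order_trans by blast
  have Kr0: "0 \<le> K\<^sub>r" using \<rho>_bound[OF theta_in] norm_ge_zero order_trans by blast
  have b0: "0 \<le> \<kappa> * (2 * C\<^sub>l / \<beta> + K\<^sub>r)" using k0 Cl0 Kr0 params by simp
  show ?thesis
  proof (cases n)
    case 0
    then show ?thesis using b0 by (simp add: C\<^sub>V_def)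
  next
    case (Suc j)
    let ?t = "\<theta> (Suc (Suc j))" and ?W = "V (Suc (Suc j))"
    have "R ?t ?W = (1 / \<beta>) *\<^sub>R (l (Suc (Suc j)) - l (Suc j))"
      using params by (simp add: l_update[of "Suc j"])
    then have "norm (R ?t ?W) = norm (l (Suc (Suc j)) - l (Suc j)) / \<beta>"
      using params by simp
    also have "\<dots> \<le> 2 * C\<^sub>l / \<beta>"
      using params norm_l_le[of j] norm_l_le[of "Suc j"]
        norm_triangle_ineq4[of "l (Suc (Suc j))" "l (Suc j)"]
      by (intro divide_right_mono) auto
    finally have R: "norm (R ?t ?W) \<le> 2 * C\<^sub>l / \<beta>" .
    have "?W = N ?t *v (R ?t ?W + \<rho> ?t)"
      by (simp add: R_eq matrix_vector_mul_assoc inverse)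
    then have "norm ?W \<le> spectral_norm (N ?t) * norm (R ?t ?W + \<rho> ?t)"
      using norm_matrix_vector_mult_le by metis
    also have "\<dots> \<le> \<kappa> * (2 * C\<^sub>l / \<beta> + K\<^sub>r)"
      using R \<rho>_bound[of ?t] norm_triangle_ineq[of "R ?t ?W" "\<rho> ?t"] k0
      by (intro mult_mono kappa) auto
    finally show ?thesis using Suc by (simp add: C\<^sub>V_def add_increasing)
  qed
qed

section \<open>Bounding the KKT residual by the increments\<close>

text \<open>The first two summands are the subgradient at the new \<theta> that the \<theta>-step
  supplies, still built from old data; the last is the Jacobian term of the KKT system at the new
  triple. The sum is the witness that bounds the distance in the residual.\<close>

definition dual_element :: "nat \<Rightarrow> real^'p" where
  "dual_element k = - grad (penalty R \<beta> (V k) (l k)) (\<theta> k) - (1 / \<eta> k) *\<^sub>R (\<theta> (Suc k) - \<theta> k)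
     + adjoint (DR (\<theta> (Suc k)) (V (Suc k))) (l (Suc k))"

lemma kkt_residual_le:
  "kkt_residual \<phi> \<Theta> c M R (\<theta> (Suc k)) (V (Suc k)) (l (Suc k))
     \<le> ereal ((norm (dual_element k))\<^sup>2 + (norm (V (Suc k) - V k))\<^sup>2 / \<eta>V\<^sup>2
         + (norm (l (Suc k) - l k))\<^sup>2 / \<beta>\<^sup>2)"
proof -
  let ?t = "\<theta> (Suc k)" and ?W = "V (Suc k)" and ?g = "grad (penalty R \<beta> (V k) (l k)) (\<theta> k)"
  let ?D = "(\<lambda>v. v + adjoint (DR ?t ?W) (l (Suc k))) ` limiting_subdiff (restrict_to \<Theta> \<phi>) ?t"
  have "- ?g - (2 * (1 / (2 * \<eta> k))) *\<^sub>R (?t - \<theta> k) \<in> regular_subdiff (restrict_to \<Theta> \<phi>) ?t"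
    by (rule prox_minimizer_regular_subdiff) (rule theta_in, rule phi_theta, rule theta_min)
  then have "- ?g - (1 / \<eta> k) *\<^sub>R (?t - \<theta> k) \<in> limiting_subdiff (restrict_to \<Theta> \<phi>) ?t"
    using regular_subdiff_subset_limiting by auto
  then have "dual_element k \<in> ?D" unfolding dual_element_def by (rule imageI)
  then have "edist_set 0 ?D \<le> ereal (dist 0 (dual_element k))"
    unfolding edist_set_def by (rule INF_lower)
  moreover have "0 \<le> edist_set 0 ?D"
    unfolding edist_set_def by (intro INF_greatest) simp
  \<comment> \<open>The witness makes the extended distance a nonnegative real, on which squaring is
    monotone.\<close>
  ultimately obtain x where x: "edist_set 0 ?D = ereal x" "0 \<le> x" "x \<le> norm (dual_element k)"
    by (cases "edist_set 0 ?D") auto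
  have dist: "(edist_set 0 ?D)\<^sup>2 \<le> ereal ((norm (dual_element k))\<^sup>2)"
    using x by (simp add: power_mono)
  have "c + transpose (M ?t) *v l (Suc k) = - ((1 / \<eta>V) *\<^sub>R (?W - V k))"
    using V_stationary[of k] by (simp add: eq_neg_iff_add_eq_0)
  then have stat: "(norm (c + transpose (M ?t) *v l (Suc k)))\<^sup>2 = (norm (?W - V k))\<^sup>2 / \<eta>V\<^sup>2"
    by (simp only: norm_minus_cancel norm_scaleR power_mult_distrib) (simp add: power_divide)
  have feas: "(norm (R ?t ?W))\<^sup>2 = (norm (l (Suc k) - l k))\<^sup>2 / \<beta>\<^sup>2"
    using params by (simp add: l_update power_mult_distrib)
  show ?thesis
    unfolding kkt_residual_def stat feas
    using add_right_mono[OF dist,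
        of "ereal ((norm (?W - V k))\<^sup>2 / \<eta>V\<^sup>2 + (norm (l (Suc k) - l k))\<^sup>2 / \<beta>\<^sup>2)"]
    by (simp add: add.assoc)
qed

text \<open>Per unit of V-increment: the change of the Jacobian, \<open>B\<^sub>M\<close>, acts on a
  multiplier of size \<open>C\<^sub>l\<close>, and a Jacobian of size
  \<open>B\<^sub>M * C\<^sub>V + B\<^sub>r\<close> acts on a multiplier change of size
  \<open>\<beta> * K\<^sub>M\<close>.\<close>

definition C\<^sub>D :: real where
  "C\<^sub>D = B\<^sub>M * C\<^sub>l + (B\<^sub>M * C\<^sub>V + B\<^sub>r) * (\<beta> * K\<^sub>M)"

text \<open>Inserting the old penalty's gradient at the new \<theta> separates the change of V and
  lambda at fixed \<theta> from the change of \<theta> at fixed penalty; the latter is covered by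
  the Lipschitz constant.\<close>

lemma norm_dual_element_le:
  "norm (dual_element (Suc n))
     \<le> (Lbar + 1 / \<eta>low) * norm (\<theta> (Suc (Suc n)) - \<theta> (Suc n))
       + C\<^sub>D * norm (V (Suc (Suc n)) - V (Suc n))"
proof -
  let ?k = "Suc n"
  let ?t = "\<theta> (Suc ?k)" and ?W = "V (Suc ?k)" and ?h = "penalty R \<beta> (V ?k) (l ?k)"
  let ?DM = "frechet_derivative M (at ?t)" and ?D\<rho> = "frechet_derivative \<rho> (at ?t)"
  let ?d = "?W - V ?k"
  \<comment> \<open>The multiplier inside the old penalty's gradient at the new \<theta>. It differs
    from the new multiplier only by \<beta> M applied to the V-increment, so no multiplier increment
    enters.\<close>
  define y where "y = l ?k + \<beta> *\<^sub>R R ?t (V ?k)"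
  \<comment> \<open>A unit vector forces the derivative bounds, given without a sign, to be
    nonnegative.\<close>
  obtain u0 :: "real^'p" where u0: "norm u0 = 1" using vector_choose_size[of 1] by auto
  have BM0: "0 \<le> B\<^sub>M" 
    using DM_bounded[of 0 u0] spectral_norm_nonneg[of "frechet_derivative M (at (\<theta> 0)) u0"]
    unfolding u0 by linarith
  have Br0: "0 \<le> B\<^sub>r" 
    using D\<rho>_bounded[of 0 u0] norm_ge_zero[of "frechet_derivative \<rho> (at (\<theta> 0)) u0"]
    unfolding u0 by linarith
  have CV0: "0 \<le> C\<^sub>V" using norm_V_le norm_ge_zero order_trans by blast
  have "l (Suc ?k) - y = \<beta> *\<^sub>R (M ?t *v ?d)"
    by (simp add: y_def l_update[of ?k] R_eq matrix_vector_mult_diff_distrib algebra_simps)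
  then have ly: "norm (l (Suc ?k) - y) \<le> \<beta> * (K\<^sub>M * norm ?d)"
    using params norm_matrix_vector_mult_le[of "M ?t" ?d]
      mult_right_mono[OF M_bound[OF theta_in[of "Suc ?k"]], of "norm ?d"]
    by simp
  have "norm (adjoint (DR ?t ?W) (l (Suc ?k)) - adjoint (DR ?t (V ?k)) y)
      \<le> (B\<^sub>M * norm ?d) * norm (l (Suc ?k)) + (B\<^sub>M * C\<^sub>V + B\<^sub>r) * norm (l (Suc ?k) - y)"
  proof (rule adjoint_diff_norm_le)
    fix u
    have "norm (?DM u *v ?d) \<le> (B\<^sub>M * norm u) * norm ?d"
      by (meson norm_matrix_vector_mult_le DM_bounded mult_right_mono norm_ge_zero order_trans)
    then show "norm (DR ?t ?W u - DR ?t (V ?k) u) \<le> B\<^sub>M * norm ?d * norm u"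
      by (simp add: DR_eq matrix_vector_mult_diff_distrib algebra_simps)
    have "norm (?DM u *v V ?k) \<le> spectral_norm (?DM u) * norm (V ?k)"
      by (rule norm_matrix_vector_mult_le)
    also have "\<dots> \<le> (B\<^sub>M * norm u) * C\<^sub>V"
      using BM0 by (intro mult_mono DM_bounded norm_V_le) auto
    finally show "norm (DR ?t (V ?k) u) \<le> (B\<^sub>M * C\<^sub>V + B\<^sub>r) * norm u"
      using D\<rho>_bounded[of "Suc ?k" u] norm_triangle_ineq4[of "?DM u *v V ?k" "?D\<rho> u"]
      by (simp add: DR_eq algebra_simps)
  qed (use BM0 Br0 CV0 in \<open>simp_all add: linear_DR\<close>)
  also have "\<dots> \<le> (B\<^sub>M * norm ?d) * C\<^sub>l + (B\<^sub>M * C\<^sub>V + B\<^sub>r) * (\<beta> * (K\<^sub>M * norm ?d))"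
    using BM0 Br0 CV0 by (intro add_mono mult_left_mono ly norm_l_le) auto
  also have "\<dots> = C\<^sub>D * norm ?d" by (simp add: C\<^sub>D_def algebra_simps)
  finally have a: "norm (adjoint (DR ?t ?W) (l (Suc ?k)) - grad ?h ?t) \<le> C\<^sub>D * norm ?d"
    by (simp add: grad_penalty y_def)
  have "norm (grad ?h ?t - grad ?h (\<theta> ?k)) \<le> L ?k * norm (?t - \<theta> ?k)"
    using lipschitz_onD[OF h_lipschitz[of ?k], of ?t "\<theta> ?k"] by (simp add: dist_norm)
  also have "\<dots> \<le> Lbar * norm (?t - \<theta> ?k)"
    by (intro mult_right_mono L_upper) simp
  finally have b: "norm (grad ?h ?t - grad ?h (\<theta> ?k)) \<le> Lbar * norm (?t - \<theta> ?k)" .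
  have "norm ((1 / \<eta> ?k) *\<^sub>R (?t - \<theta> ?k)) = (1 / \<eta> ?k) * norm (?t - \<theta> ?k)"
    using params(3)[of ?k] by simp
  also have "\<dots> \<le> (1 / \<eta>low) * norm (?t - \<theta> ?k)"
    using step_lower(1) step_lower(2)[of ?k] by (intro mult_right_mono divide_left_mono) auto
  finally have e: "norm ((1 / \<eta> ?k) *\<^sub>R (?t - \<theta> ?k)) \<le> (1 / \<eta>low) * norm (?t - \<theta> ?k)" .
  have triangle: "norm (x + y - z) \<le> norm x + norm y + norm z" for x y z :: "real^'p"
    using norm_triangle_ineq[of x y] norm_triangle_ineq4[of "x + y" z] by linarith
  have "dual_element ?k = (adjoint (DR ?t ?W) (l (Suc ?k)) - grad ?h ?t)
      + (grad ?h ?t - grad ?h (\<theta> ?k)) - (1 / \<eta> ?k) *\<^sub>R (?t - \<theta> ?k)"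
    unfolding dual_element_def by simp
  then have "norm (dual_element ?k) \<le> norm (adjoint (DR ?t ?W) (l (Suc ?k)) - grad ?h ?t)
      + norm (grad ?h ?t - grad ?h (\<theta> ?k)) + norm ((1 / \<eta> ?k) *\<^sub>R (?t - \<theta> ?k))"
    by (simp only: triangle)
  then show ?thesis using a b e unfolding distrib_right by linarith
qed

text \<open>The factors 2 come from squaring the two-term bound on \<open>dual_element\<close>; the
  remaining summands are the V-stationarity block and the feasibility block, the latter through
  \<open>multiplier_increment\<close>.\<close>

definition C\<^sub>G :: real where
  "C\<^sub>G = 2 * (Lbar + 1 / \<eta>low)\<^sup>2 + 2 * C\<^sub>D\<^sup>2 + 1 / \<eta>V\<^sup>2 + (A + B) / \<beta>\<^sup>2"

lemma A_B_nonneg: "0 \<le> A" "0 \<le> B"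
  by (simp_all add: A_eq B_eq)

lemma C\<^sub>G_nonneg: "0 \<le> C\<^sub>G"
  using A_B_nonneg by (simp add: C\<^sub>G_def)

lemma kkt_residual_le_S:
  "kkt_residual \<phi> \<Theta> c M R (\<theta> (Suc (Suc n))) (V (Suc (Suc n))) (l (Suc (Suc n))) \<le> ereal (C\<^sub>G * S n)"
proof -
  let ?x = "norm (\<theta> (Suc (Suc n)) - \<theta> (Suc n))"
  let ?y = "norm (V (Suc (Suc n)) - V (Suc n))"
  have "(norm (dual_element (Suc n)))\<^sup>2 \<le> ((Lbar + 1 / \<eta>low) * ?x + C\<^sub>D * ?y)\<^sup>2"
    by (intro power_mono norm_dual_element_le) simp
  also have "\<dots> \<le> 2 * (Lbar + 1 / \<eta>low)\<^sup>2 * ?x\<^sup>2 + 2 * C\<^sub>D\<^sup>2 * ?y\<^sup>2"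
    using zero_le_power2[of "(Lbar + 1 / \<eta>low) * ?x - C\<^sub>D * ?y"]
    unfolding power2_sum power2_diff power_mult_distrib by linarith
  also have "\<dots> \<le> 2 * (Lbar + 1 / \<eta>low)\<^sup>2 * S n + 2 * C\<^sub>D\<^sup>2 * S n"
    by (intro add_mono mult_left_mono) (auto simp: S_def)
  finally have 1: "(norm (dual_element (Suc n)))\<^sup>2
      \<le> 2 * (Lbar + 1 / \<eta>low)\<^sup>2 * S n + 2 * C\<^sub>D\<^sup>2 * S n" .
  have "?y\<^sup>2 \<le> S n" by (simp add: S_def)
  then have 2: "?y\<^sup>2 / \<eta>V\<^sup>2 \<le> 1 / \<eta>V\<^sup>2 * S n"
    by (simp add: divide_right_mono)
  have "(norm (l (Suc (Suc n)) - l (Suc n)))\<^sup>2 \<le> A * S n + B * S n"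
    using A_B_nonneg
    by (intro order_trans[OF multiplier_increment] add_mono mult_left_mono) (auto simp: S_def)
  then have "(norm (l (Suc (Suc n)) - l (Suc n)))\<^sup>2 / \<beta>\<^sup>2 \<le> (A * S n + B * S n) / \<beta>\<^sup>2"
    by (intro divide_right_mono) auto
  then have 3: "(norm (l (Suc (Suc n)) - l (Suc n)))\<^sup>2 / \<beta>\<^sup>2 \<le> (A + B) / \<beta>\<^sup>2 * S n"
    by (simp add: distrib_right)
  have "(norm (dual_element (Suc n)))\<^sup>2 + ?y\<^sup>2 / \<eta>V\<^sup>2
      + (norm (l (Suc (Suc n)) - l (Suc n)))\<^sup>2 / \<beta>\<^sup>2 \<le> C\<^sub>G * S n"
    using 1 2 3 unfolding C\<^sub>G_def distrib_right by linarith
  then show ?thesis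
    using kkt_residual_le[of "Suc n"] by (meson ereal_less_eq(3) order_trans)
qed

lemma lyapunov_eq: "lyapunov \<phi> c R \<beta> \<tau> \<theta> V l (Suc n) = ereal (lyap n)"
  by (simp add: lyapunov_def aug_lagrangian_eq lyap_def merit_def bdiff_def)

lemma lyapunov_decreasing:
  assumes "1 \<le> k"
  shows "lyapunov \<phi> c R \<beta> \<tau> \<theta> V l (k + 1) \<le> lyapunov \<phi> c R \<beta> \<tau> \<theta> V l k"
proof -
  obtain n where k: "k = Suc n" using assms by (cases k) auto
  have "0 \<le> \<delta> * S n" using delta_pos S_nonneg by simp
  then have "lyap (Suc n) \<le> lyap n" using lyap_step[of n] by linarith
  then show ?thesis by (simp add: k lyapunov_eq)
qed

lemma kkt_residual_tendsto_zero:
  "(\<lambda>k. kkt_residual \<phi> \<Theta> c M R (\<theta> k) (V k) (l k)) \<longlonglongrightarrow> 0"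
proof -
  let ?G = "\<lambda>k. kkt_residual \<phi> \<Theta> c M R (\<theta> k) (V k) (l k)"
  \<comment> \<open>The bound by \<open>S\<close> begins at the second iterate; dropping two terms
    does not change the limit.\<close>
  have "(\<lambda>n. ?G (Suc (Suc n))) \<longlonglongrightarrow> 0"
  proof (rule tendsto_sandwich[OF _ _ tendsto_const])
    have "(\<lambda>n. C\<^sub>G * S n) \<longlonglongrightarrow> C\<^sub>G * 0" by (intro tendsto_intros S_tendsto)
    then show "(\<lambda>n. ereal (C\<^sub>G * S n)) \<longlonglongrightarrow> 0" by (simp add: zero_ereal_def)
    show "\<forall>\<^sub>F n in sequentially. 0 \<le> ?G (Suc (Suc n))"
    proof (intro always_eventually allI)
      fix n
      show "0 \<le> ?G (Suc (Suc n))"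
        unfolding kkt_residual_def power2_eq_square
        by (intro add_nonneg_nonneg mult_nonneg_nonneg) (auto simp: edist_set_def intro!: INF_greatest ereal_0_le_mult)
    qed
  qed (simp add: kkt_residual_le_S)
  then show ?thesis by (intro LIMSEQ_imp_Suc[of ?G] LIMSEQ_imp_Suc[of "\<lambda>n. ?G (Suc n)"])
qed

lemma kkt_residual_increment_bound:
  assumes "1 \<le> k"
  shows "kkt_residual \<phi> \<Theta> c M R (\<theta> (k + 1)) (V (k + 1)) (l (k + 1))
    \<le> ereal (C\<^sub>G * ((norm (bdiff \<theta> (k + 1)))\<^sup>2 + (norm (bdiff V (k + 1)))\<^sup>2 + (norm (bdiff V k))\<^sup>2))"
proof -
  obtain n where k: "k = Suc n" using assms by (cases k) auto
  show ?thesis using kkt_residual_le_S[of n] by (simp add: k bdiff_def S_def)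
qed

text \<open>If all of the first T residuals exceeded C / T, their real majorants \<open>g\<close>
  would sum to more than C, against the summability of \<open>S\<close>.\<close>

lemma kkt_residual_min_rate:
  "\<exists>C::real. \<forall>T\<ge>1. Min ((\<lambda>k. kkt_residual \<phi> \<Theta> c M R (\<theta> k) (V k) (l k)) ` {1..T}) \<le> ereal (C / real T)"
proof -
  let ?G = "\<lambda>k. kkt_residual \<phi> \<Theta> c M R (\<theta> k) (V k) (l k)"
  \<comment> \<open>At k = 1 the multiplier increment contains the initial multiplier, so only
    finiteness of the residual is available; it is charged once to C.\<close>
  obtain g1 where g1: "?G 1 \<le> ereal g1" using kkt_residual_le[of 0] by auto
  define g where "g j = (case j of 0 \<Rightarrow> g1 | Suc n \<Rightarrow> C\<^sub>G * S n)" for j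
  define C where "C = g1 + C\<^sub>G * K"
  have G: "?G (Suc j) \<le> ereal (g j)" for j
    using g1 kkt_residual_le_S by (cases j) (auto simp: g_def)
  have sum: "(\<Sum>j<Suc n. g j) \<le> C" for n
  proof -
    have "(\<Sum>j<Suc n. g j) = g1 + C\<^sub>G * (\<Sum>j<n. S j)"
      unfolding sum.lessThan_Suc_shift by (simp add: g_def sum_distrib_left)
    then show ?thesis using sum_S_le[of n] C\<^sub>G_nonneg by (simp add: C_def mult_left_mono)
  qed
  have "Min (?G ` {1..T}) \<le> ereal (C / real T)" if T: "1 \<le> T" for T
  proof (rule ccontr)
    assume "\<not> ?thesis"
    then have less: "ereal (C / real T) < Min (?G ` {1..T})" by simp
    have "C / real T < g j" if "j < T" for j
    proof -
      have "Min (?G ` {1..T}) \<le> ?G (Suc j)" using that by (intro Min_le) auto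
      then have "ereal (C / real T) < ereal (g j)" using less G[of j] by order
      then show ?thesis by simp
    qed
    then have "(\<Sum>j<T. C / real T) < (\<Sum>j<T. g j)"
      using T by (intro sum_strict_mono) (auto simp: lessThan_empty_iff)
    moreover have "(\<Sum>j<T. C / real T) = C" using T by simp
    ultimately show False using sum[of "T - 1"] T by simp
  qed
  then show ?thesis by blast
qed

end

section \<open>Specialization to the discounted Markov decision process\<close>

theorem theoremE9:
  fixes P :: "'s::finite \<Rightarrow> 'a::finite \<Rightarrow> 's \<Rightarrow> real"
    and r :: "'s \<Rightarrow> 'a \<Rightarrow> real"
    and \<gamma> :: real
    and \<Theta> U :: "(real^'p) set"
    and \<pi> :: "real^'p \<Rightarrow> 's \<Rightarrow> 'a \<Rightarrow> real"
    and \<phi> :: "real^'p \<Rightarrow> ereal"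
    and c :: "real^'s"
    and \<beta> \<eta>V \<tau> L\<^sub>M \<kappa>\<^sub>M A\<^sub>A B\<^sub>A \<eta>low Lbar \<alpha> :: real
    and \<eta> L :: "nat \<Rightarrow> real"
    and \<theta> :: "nat \<Rightarrow> real^'p"
    and V l :: "nat \<Rightarrow> real^'s"
    and M :: "real^'p \<Rightarrow> real^'s^'s"
    and R :: "real^'p \<Rightarrow> real^'s \<Rightarrow> real^'s"
    and \<Phi> G :: "nat \<Rightarrow> ereal"
  assumes M_eq: "M = bellman_matrix P \<gamma> \<pi>"
    and R_eq: "R = bellman_residual P r \<gamma> \<pi>"
    and kappa_eq: "\<kappa>\<^sub>M = (SUP t\<in>\<Theta>. spectral_norm (matrix_inv (M t)))"
    and A_eq: "A\<^sub>A = 3 * \<kappa>\<^sub>M ^ 4 * L\<^sub>M\<^sup>2 * (norm c)\<^sup>2"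
    and B_eq: "B\<^sub>A = 3 * \<kappa>\<^sub>M\<^sup>2 / \<eta>V\<^sup>2"
    and Phi_eq: "\<Phi> = lyapunov \<phi> c R \<beta> \<tau> \<theta> V l"
    and G_eq: "G = (\<lambda>k. kkt_residual \<phi> \<Theta> c M R (\<theta> k) (V k) (l k))"
    and mdp: "transition_kernel P" "0 < \<gamma>" "\<gamma> < 1"
    and Theta: "closed \<Theta>" "convex \<Theta>"
    and policy: "open U" "\<Theta> \<subseteq> U" "smooth_policy_on U \<pi>"
    and psi: "proper_fun (restrict_to \<Theta> \<phi>)" "lsc_fun (restrict_to \<Theta> \<phi>)"
             "bounded_below_on UNIV (restrict_to \<Theta> \<phi>)"
    and M_lipschitz: "\<And>t t'. t \<in> \<Theta> \<Longrightarrow> t' \<in> \<Theta> \<Longrightarrow>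
                        spectral_norm (M t - M t') \<le> L\<^sub>M * norm (t - t')"
    and reduced: "bounded_below_on \<Theta> (reduced_objective \<phi> c P r \<gamma> \<pi>)"
    and params: "0 < \<beta>" "0 < \<eta>V" "\<And>k. 0 < \<eta> k"
    and algorithm: "bellman_admm \<phi> \<Theta> c R \<beta> \<eta>V \<eta> \<theta> V l"
    and tau: "B\<^sub>A / \<beta> < \<tau>" "\<tau> < 1 / (2 * \<eta>V) - B\<^sub>A / \<beta>"
    and DM_bounded: "\<exists>B. \<forall>k u. spectral_norm (frechet_derivative M (at (\<theta> k)) u) \<le> B * norm u"
    and Dr_bounded: "\<exists>B. \<forall>k u. norm (frechet_derivative (policy_reward r \<pi>) (at (\<theta> k)) u) \<le> B * norm u"
    and h_lipschitz: "\<And>k. (L k)-lipschitz_on (closed_segment (\<theta> k) (\<theta> (Suc k)))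
                             (grad (penalty R \<beta> (V k) (l k)))"
    and step_lower: "0 < \<eta>low" "\<And>k. \<eta>low \<le> \<eta> k"
    and L_upper: "\<And>k. L k \<le> Lbar"
    and step_cond: "0 < \<alpha>" "\<And>k. 1 / (2 * \<eta> k) - L k / 2 - A\<^sub>A / \<beta> \<ge> \<alpha>"
  shows "(\<forall>k\<ge>1. \<Phi> (k + 1) \<le> \<Phi> k) \<and>
         G \<longlonglongrightarrow> 0 \<and>
         (\<exists>C\<^sub>G::real. \<forall>k\<ge>1. G (k + 1) \<le>
            ereal (C\<^sub>G * ((norm (bdiff \<theta> (k + 1)))\<^sup>2 + (norm (bdiff V (k + 1)))\<^sup>2
                         + (norm (bdiff V k))\<^sup>2))) \<and>
         (\<exists>C::real. \<forall>T\<ge>1. Min (G ` {1..T}) \<le> ereal (C / real T))"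
proof -
  have \<pi>: "0 \<le> \<pi> t s a" "(\<Sum>a\<in>UNIV. \<pi> t s a) = 1" if "t \<in> \<Theta>" for t s a
    using policy that unfolding smooth_policy_on_def by blast+
  have \<pi>_diff: "(\<lambda>t. \<pi> t s a) differentiable (at t)" if "t \<in> \<Theta>" for t s a
  proof -
    have "Ck_on 1 (\<lambda>t. \<pi> t s a) U"
      using policy(3) unfolding smooth_policy_on_def smooth_fun_on_def by blast
    then have "(\<lambda>t. \<pi> t s a) differentiable_on U" by simp
    then show ?thesis
      using policy that by (auto simp: differentiable_on_eq_differentiable_at)
  qed
  obtain m where m: "\<And>t. t \<in> \<Theta> \<Longrightarrow> ereal m \<le> reduced_objective \<phi> c P r \<gamma> \<pi> t"
    using reduced unfolding bounded_below_on_def by blast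
  obtain B\<^sub>M where B\<^sub>M: "\<And>k u. spectral_norm (frechet_derivative M (at (\<theta> k)) u) \<le> B\<^sub>M * norm u"
    using DM_bounded by blast
  obtain B\<^sub>r where
    B\<^sub>r: "\<And>k u. norm (frechet_derivative (policy_reward r \<pi>) (at (\<theta> k)) u) \<le> B\<^sub>r * norm u"
    using Dr_bounded by blast
  interpret bellman_admm_run \<phi> \<Theta> c M "policy_reward r \<pi>" R \<beta> \<eta>V \<eta> L \<theta> V l \<kappa>\<^sub>M L\<^sub>M
    "2 * real CARD('s)" "\<Sum>s\<in>UNIV. \<Sum>a\<in>UNIV. \<bar>r s a\<bar>" m \<tau> \<eta>low Lbar \<alpha> B\<^sub>M B\<^sub>r A\<^sub>A B\<^sub>A
  proof
    show "R = (\<lambda>t W. M t *v W - policy_reward r \<pi> t)"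
      by (intro ext) (simp add: R_eq M_eq bellman_residual_def)
    fix t assume t: "t \<in> \<Theta>"
    note \<pi>t = \<pi>[OF t]
    show "M differentiable (at t)" "policy_reward r \<pi> differentiable (at t)"
      unfolding M_eq using t
      by (intro differentiable_bellman_matrix differentiable_policy_reward \<pi>_diff; simp)+
    show "matrix_inv (M t) ** M t = mat 1" "M t ** matrix_inv (M t) = mat 1"
      unfolding M_eq using bellman_matrix_inverse[where \<pi>=\<pi> and t=t, OF mdp(1) \<pi>t mdp(2,3)] by blast+
    show "spectral_norm (M t) \<le> 2 * real CARD('s)"
      unfolding M_eq by (rule spectral_norm_bellman_matrix_le[where \<pi>=\<pi> and t=t, OF mdp(1) \<pi>t mdp(2,3)])
    show "norm (policy_reward r \<pi> t) \<le> (\<Sum>s\<in>UNIV. \<Sum>a\<in>UNIV. \<bar>r s a\<bar>)"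
      by (rule norm_policy_reward_le[where \<pi>=\<pi> and t=t, OF mdp(1) \<pi>t mdp(2,3)])
    \<comment> \<open>A real supremum dominates its members only if the set is bounded above; the
      uniform inverse bound ensures this for \<open>\<kappa>\<^sub>M\<close>.\<close>
    have "spectral_norm (matrix_inv (M t')) \<le> real CARD('s) / (1 - \<gamma>)" if "t' \<in> \<Theta>" for t'
      unfolding M_eq by (rule spectral_norm_bellman_inverse_le[where \<pi>=\<pi> and t=t', OF mdp(1) \<pi>[OF that] mdp(2,3)])
    then have "bdd_above ((\<lambda>t. spectral_norm (matrix_inv (M t))) ` \<Theta>)"
      by (intro bdd_aboveI2)
    then show "spectral_norm (matrix_inv (M t)) \<le> \<kappa>\<^sub>M"
      unfolding kappa_eq using t by (intro cSUP_upper)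
    show "\<phi> t \<noteq> -\<infinity>"
      using psi(1) t unfolding proper_fun_def restrict_to_def by metis
    show "ereal m \<le> \<phi> t + ereal (c \<bullet> (matrix_inv (M t) *v policy_reward r \<pi> t))"
      using m[OF t] by (simp add: reduced_objective_def M_eq)
  qed (fact Theta M_lipschitz params algorithm A_eq B_eq tau B\<^sub>M B\<^sub>r h_lipschitz step_lower L_upper
      step_cond)+
  show ?thesis
    unfolding Phi_eq G_eq
    using lyapunov_decreasing kkt_residual_tendsto_zero kkt_residual_increment_bound
      kkt_residual_min_rate
    by blast
qed

end
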